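(* Let $k\ge 1$ be an integer. If $\Gamma=(A,B,E)$ is a highly computable, computably bipartite graph satisfying the computable expanding Hall's harem condition with respect to $k$ (denoted $c.e.H.h.c.(k)$), then $\Gamma$ has a computable perfect $(1,k)$-matching.
   Context: Here $\mathbb{N}=\{0,1,2,\dots\}$. A bipartite graph $\Gamma=(A,B,E)$ has vertex set $V=A\sqcup B$ and edge set $E\subseteq A\times B$. Vertices $a\in A$, $b\in B$ are adjacent if $(a,b)\in E$. For a vertex $x$, $N_\Gamma(x)$ (also written $N(x)$) is the set of vertices adjacent to $x$; for $X\subseteq A$ or $X\subseteq B$, $N(X)=\bigcup_{x\in X}N(x)$. $\Gamma$ is locally finite if $N(x)$ is finite for every vertex $x$. $\Gamma$ is computable if there is a bijection $\nu:\mathbb{N}\to V$ such that $\{(i,j):(\nu(i),\nu(j))\in E\}$ is a computable set. It is computably bipartite if it is computable with respect to some $\nu$ and moreover $\nu^{-1}(A)\subseteq\mathbb{N}$ is computable. A locally finite graph is highly computable if it is computable (with respect to $\nu$) and the function $n\mapsto |N_\Gamma(\nu(n))|$ is computable. The same fixed $\nu$ is used for all computability notions concerning $\Gamma$. A perfect $(1,k)$-matching for $\Gamma$ is a subset $M\subseteq E$ such that (1) for every $a\in A$ there are exactly $k$ vertices $b\in B$ with $(a,b)\in M$; (2) for every $b\in B$ there is a unique $a\in A$ with $(a,b)\in M$. It is computable if $\{(i,j):(\nu(i),\nu(j))\in M\}\subseteq\mathbb{N}\times\mathbb{N}$ is computable. $\Gamma$ satisfies $c.e.H.h.c.(k)$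 if there is a total computable function $h:\mathbb{N}\to\mathbb{N}$ such that: $h(0)=0$; for all finite $X\subseteq A$ and all $n\in\mathbb{N}$, $h(n)\le |X|$ implies $n\le |N(X)|-k|X|$; and for all finite $Y\subseteq B$ and all $n\in\mathbb{N}$, $h(n)\le |Y|$ implies $n\le |N(Y)|-\frac1k|Y|$. *)

theory Defs
  imports Complex_Main
begin

section \<open>Computable functions on the natural numbers\<close>

text \<open>
  Kleene's partial recursive functions, given by programs and a big-step evaluation relation.
  Programs carry no arity; a program applied to an argument list of the wrong length
  simply has no value.
\<close>

datatype prog =
    Zero
  | Succ
  | Proj nat
  | Comp prog "prog list"
  | Prec prog prog
  | Mu prog

inductive evals_to :: "prog \<Rightarrow> nat list \<Rightarrow> nat \<Rightarrow> bool" where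
  zero: "evals_to Zero xs 0"
| succ: "evals_to Succ [x] (Suc x)"
| proj: "i < length xs \<Longrightarrow> evals_to (Proj i) xs (xs ! i)"
| comp: "list_all2 (\<lambda>g y. evals_to g xs y) gs ys \<Longrightarrow> evals_to f ys z
          \<Longrightarrow> evals_to (Comp f gs) xs z"
| prec_0: "evals_to f xs y \<Longrightarrow> evals_to (Prec f g) (0 # xs) y"
| prec_Suc: "evals_to (Prec f g) (n # xs) y \<Longrightarrow> evals_to g (n # y # xs) z
          \<Longrightarrow> evals_to (Prec f g) (Suc n # xs) z"
| mu: "evals_to f (n # xs) 0 \<Longrightarrow> (\<forall>i<n. \<exists>y. evals_to f (i # xs) (Suc y))
          \<Longrightarrow> evals_to (Mu f) xs n"

inductive_cases evals_to_elims:
  "evals_to Zero xs y"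
  "evals_to Succ xs y"
  "evals_to (Proj i) xs y"
  "evals_to (Comp f gs) xs y"
  "evals_to (Prec f g) (0 # xs) y"
  "evals_to (Prec f g) (Suc n # xs) y"
  "evals_to (Mu f) xs y"

lemma evals_to_deterministic:
  "evals_to p xs y \<Longrightarrow> evals_to p xs y' \<Longrightarrow> y = y'"
proof (induction arbitrary: y' rule: evals_to.induct)
  case (comp xs gs ys f z)
  from comp.prems obtain ys' where ys': "list_all2 (\<lambda>g y. evals_to g xs y) gs ys'"
    and f: "evals_to f ys' y'"
    by (rule evals_to_elims(4))
  have "ys = ys'"
  proof (rule nth_equalityI)
    show "length ys = length ys'"
      using list_all2_lengthD[OF comp.IH(1)] list_all2_lengthD[OF ys'] by simp
    show "ys ! i = ys' ! i" if "i < length ys" for i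
    proof -
      have "i < length gs"
        using list_all2_lengthD[OF comp.IH(1)] that by simp
      then show ?thesis
        using list_all2_nthD[OF comp.IH(1)] list_all2_nthD[OF ys'] by blast
    qed
  qed
  then show ?case using comp.IH(2) f by blast
next
  case (mu f n xs)
  from mu.prems have y': "evals_to f (y' # xs) 0 \<and> (\<forall>i<y'. \<exists>y. evals_to f (i # xs) (Suc y))"
    by (rule evals_to_elims(7)) (intro conjI)
  have "\<not> n < y'" using mu.IH(1) y' by blast
  moreover have "\<not> y' < n" using mu.IH(2) y' by blast
  ultimately show ?case by simp
qed (blast elim: evals_to_elims)+

definition computable_fun :: "(nat \<Rightarrow> nat) \<Rightarrow> bool" where
  "computable_fun f \<longleftrightarrow> (\<exists>p. \<forall>x. evals_to p [x] (f x))"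

definition computable_set :: "nat set \<Rightarrow> bool" where
  "computable_set S \<longleftrightarrow> (\<exists>p. \<forall>x. evals_to p [x] (if x \<in> S then 1 else 0))"

definition computable_rel :: "(nat \<times> nat) set \<Rightarrow> bool" where
  "computable_rel R \<longleftrightarrow> (\<exists>p. \<forall>x y. evals_to p [x, y] (if (x, y) \<in> R then 1 else 0))"

section \<open>Bipartite graphs\<close>

definition bipartite_graph :: "'v set \<Rightarrow> 'v set \<Rightarrow> ('v \<times> 'v) set \<Rightarrow> bool" where
  "bipartite_graph A B E \<longleftrightarrow> A \<inter> B = {} \<and> E \<subseteq> A \<times> B"

text \<open>Edges are stored oriented from the first part to the second; adjacency is symmetric.\<close>

definition nbhd :: "('v \<times> 'v) set \<Rightarrow> 'v \<Rightarrow> 'v set" where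
  "nbhd E x = {y. (x, y) \<in> E \<or> (y, x) \<in> E}"

definition nbhd_set :: "('v \<times> 'v) set \<Rightarrow> 'v set \<Rightarrow> 'v set" where
  "nbhd_set E X = (\<Union>x\<in>X. nbhd E x)"

definition locally_finite :: "'v set \<Rightarrow> 'v set \<Rightarrow> ('v \<times> 'v) set \<Rightarrow> bool" where
  "locally_finite A B E \<longleftrightarrow> (\<forall>x \<in> A \<union> B. finite (nbhd E x))"

section \<open>Computability notions relative to a numbering \<open>\<nu>\<close> of the vertices\<close>

definition computable_edges :: "(nat \<Rightarrow> 'v) \<Rightarrow> ('v \<times> 'v) set \<Rightarrow> bool" where
  "computable_edges \<nu> M \<longleftrightarrow> computable_rel {(i, j). (\<nu> i, \<nu> j) \<in> M}"

definition computable_graph ::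
  "(nat \<Rightarrow> 'v) \<Rightarrow> 'v set \<Rightarrow> 'v set \<Rightarrow> ('v \<times> 'v) set \<Rightarrow> bool" where
  "computable_graph \<nu> A B E \<longleftrightarrow> bij_betw \<nu> UNIV (A \<union> B) \<and> computable_edges \<nu> E"

definition computably_bipartite ::
  "(nat \<Rightarrow> 'v) \<Rightarrow> 'v set \<Rightarrow> 'v set \<Rightarrow> ('v \<times> 'v) set \<Rightarrow> bool" where
  "computably_bipartite \<nu> A B E \<longleftrightarrow> computable_graph \<nu> A B E \<and> computable_set (\<nu> -` A)"

definition highly_computable ::
  "(nat \<Rightarrow> 'v) \<Rightarrow> 'v set \<Rightarrow> 'v set \<Rightarrow> ('v \<times> 'v) set \<Rightarrow> bool" where
  "highly_computable \<nu> A B E \<longleftrightarrow>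
     locally_finite A B E \<and> computable_graph \<nu> A B E \<and>
     computable_fun (\<lambda>n. card (nbhd E (\<nu> n)))"

section \<open>Harem matchings and the expanding Hall harem condition\<close>

definition perfect_harem_matching ::
  "nat \<Rightarrow> 'v set \<Rightarrow> 'v set \<Rightarrow> ('v \<times> 'v) set \<Rightarrow> ('v \<times> 'v) set \<Rightarrow> bool" where
  "perfect_harem_matching k A B E M \<longleftrightarrow>
     M \<subseteq> E \<and>
     (\<forall>a\<in>A. finite {b \<in> B. (a, b) \<in> M} \<and> card {b \<in> B. (a, b) \<in> M} = k) \<and>
     (\<forall>b\<in>B. \<exists>!a. a \<in> A \<and> (a, b) \<in> M)"

text \<open>
  The differences below may be negative, hence the cardinalities are taken as real numbers.
  For locally finite graphs the neighbourhoods involved are finite, so \<open>card\<close> is meaningful.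
\<close>

definition ceHhc :: "nat \<Rightarrow> 'v set \<Rightarrow> 'v set \<Rightarrow> ('v \<times> 'v) set \<Rightarrow> bool" where
  "ceHhc k A B E \<longleftrightarrow>
     (\<exists>h. computable_fun h \<and> h 0 = 0 \<and>
        (\<forall>X n. finite X \<and> X \<subseteq> A \<and> h n \<le> card X \<longrightarrow>
           real n \<le> real (card (nbhd_set E X)) - real k * real (card X)) \<and>
        (\<forall>Y n. finite Y \<and> Y \<subseteq> B \<and> h n \<le> card Y \<longrightarrow>
           real n \<le> real (card (nbhd_set E Y)) - 1 / real k * real (card Y)))"

end

theory Submission
  imports Defs "HOL-Library.Nat_Bijection"
begin

text \<open>
  Splitting every vertex of \<open>A\<close> into \<open>k\<close> copies reduces the theorem to ordinary perfect matchings in a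
  graph on the natural numbers satisfying Hall's condition on both sides, with a surplus \<open>n\<close> for sets
  of size at least \<open>h n\<close>. Such a matching is built greedily: stage \<open>s\<close> matches the vertex \<open>s\<close>, if it is
  still free, to a neighbour whose removal together with \<open>s\<close> preserves Hall's condition on both sides.
  Such a neighbour exists by an uncrossing argument for tight sets. It can be recognised effectively:
  at most \<open>2 * s\<close> vertices have been removed, so sets of size at least \<open>h (2 * s + 1)\<close> are not tight,
  and a minimal set violating Hall's condition lies in a ball of computable radius around the removed
  edge. Balls are replaced by initial segments of the natural numbers, and the radius is measured
  by iterating a computable bound \<open>G n\<close> on the neighbours of all vertices below \<open>n\<close>.
\<close>

section \<open>A calculus of computable functions\<close>

text \<open>Programs carry no arity, so the arity \<open>n\<close> is a parameter. Lists of any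
  other length are unconstrained.\<close>

definition computable_in :: "nat \<Rightarrow> (nat list \<Rightarrow> nat) \<Rightarrow> bool" where
  "computable_in n f \<longleftrightarrow> (\<exists>p. \<forall>xs. length xs = n \<longrightarrow> evals_to p xs (f xs))"

definition decidable_in :: "nat \<Rightarrow> (nat list \<Rightarrow> bool) \<Rightarrow> bool" where
  "decidable_in n P \<longleftrightarrow> computable_in n (\<lambda>xs. of_bool (P xs))"

section \<open>Composition and substitution\<close>

text \<open>
  Argument lists serve as environments: a binder prepends its variable, so below it the outer
  arguments are addressed through \<open>tl\<close>.
\<close>

lemma computable_in_cong:
  assumes "computable_in n f" "\<And>xs. length xs = n \<Longrightarrow> f xs = g xs"
  shows "computable_in n g"
  using assms unfolding computable_in_def by metis

lemma computable_in_of_bool: "decidable_in n P \<Longrightarrow> computable_in n (\<lambda>xs. of_bool (P xs))"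
  by (simp add: decidable_in_def)

text \<open>The constructor \<open>Comp\<close>. Programs are chosen as a function \<open>q\<close>
  of the inner functions, so that \<open>map q gs\<close> is the required list.\<close>

lemma computable_in_compose:
  assumes f: "computable_in (length gs) f" and gs: "\<And>g. g \<in> set gs \<Longrightarrow> computable_in n g"
  shows "computable_in n (\<lambda>xs. f (map (\<lambda>g. g xs) gs))"
proof -
  obtain p where p: "\<And>xs. length xs = length gs \<Longrightarrow> evals_to p xs (f xs)"
    using f unfolding computable_in_def by blast
  from gs have "\<forall>g. \<exists>q. g \<in> set gs \<longrightarrow> (\<forall>xs. length xs = n \<longrightarrow> evals_to q xs (g xs))"
    unfolding computable_in_def by blast
  then obtain q where q: "\<And>g xs. g \<in> set gs \<Longrightarrow> length xs = n \<Longrightarrow> evals_to (q g) xs (g xs)"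
    by metis
  have "evals_to (Comp p (map q gs)) xs (f (map (\<lambda>g. g xs) gs))" if "length xs = n" for xs
  proof (rule evals_to.comp)
    show "list_all2 (\<lambda>g y. evals_to g xs y) (map q gs) (map (\<lambda>g. g xs) gs)"
      using q that by (simp add: list_all2_conv_all_nth)
  qed (use p in simp)
  then show ?thesis unfolding computable_in_def by blast
qed

lemma computable_in_nth: "i < n \<Longrightarrow> computable_in n (\<lambda>xs. xs ! i)"
  unfolding computable_in_def by (metis evals_to.proj)

lemma computable_in_nth_tl: "Suc i < n \<Longrightarrow> computable_in n (\<lambda>xs. tl xs ! i)"
  by (rule computable_in_cong[OF computable_in_nth[of "Suc i"]]) (auto simp: nth_tl)

lemma computable_in_nth_tl2: "Suc (Suc i) < n \<Longrightarrow> computable_in n (\<lambda>xs. tl (tl xs) ! i)"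
  by (rule computable_in_cong[OF computable_in_nth[of "Suc (Suc i)"]]) (auto simp: nth_tl)

lemma computable_in_nth_tl3:
  "Suc (Suc (Suc i)) < n \<Longrightarrow> computable_in n (\<lambda>xs. tl (tl (tl xs)) ! i)"
  by (rule computable_in_cong[OF computable_in_nth[of "Suc (Suc (Suc i))"]]) (auto simp: nth_tl)

text \<open>Lifts a fact about a function of one variable to arbitrary computable arguments in any
  environment. With the variants below, each predicate of the construction is treated once, on its
  own arguments.\<close>

lemma computable_in_subst1:
  assumes "computable_in 1 (\<lambda>xs. f (xs ! 0))" "computable_in n a"
  shows "computable_in n (\<lambda>xs. f (a xs))"
  using computable_in_compose[of "[a]" "\<lambda>xs. f (xs ! 0)" n] assms by simp

lemma computable_in_subst2:
  assumes "computable_in 2 (\<lambda>xs. f (xs ! 0) (xs ! 1))" "computable_in n a" "computable_in n b"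
  shows "computable_in n (\<lambda>xs. f (a xs) (b xs))"
  using computable_in_compose[of "[a, b]" "\<lambda>xs. f (xs ! 0) (xs ! 1)" n] assms
  by (auto simp: numeral_2_eq_2)

lemma computable_in_subst3:
  assumes "computable_in 3 (\<lambda>xs. f (xs ! 0) (xs ! 1) (xs ! 2))"
    "computable_in n a" "computable_in n b" "computable_in n c"
  shows "computable_in n (\<lambda>xs. f (a xs) (b xs) (c xs))"
  using computable_in_compose[of "[a, b, c]" "\<lambda>xs. f (xs ! 0) (xs ! 1) (xs ! 2)" n] assms
  by (auto simp: numeral_3_eq_3)

lemma computable_in_subst4:
  assumes "computable_in 4 (\<lambda>xs. f (xs ! 0) (xs ! 1) (xs ! 2) (xs ! 3))"
    "computable_in n a" "computable_in n b" "computable_in n c" "computable_in n d"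
  shows "computable_in n (\<lambda>xs. f (a xs) (b xs) (c xs) (d xs))"
  using computable_in_compose[of "[a, b, c, d]" "\<lambda>xs. f (xs ! 0) (xs ! 1) (xs ! 2) (xs ! 3)" n] assms
  by (auto simp: eval_nat_numeral)

lemma decidable_in_subst1:
  assumes "decidable_in 1 (\<lambda>xs. P (xs ! 0))" "computable_in n a"
  shows "decidable_in n (\<lambda>xs. P (a xs))"
  using computable_in_subst1[of "\<lambda>x. of_bool (P x)"] assms by (simp add: decidable_in_def)

lemma decidable_in_subst2:
  assumes "decidable_in 2 (\<lambda>xs. P (xs ! 0) (xs ! 1))" "computable_in n a" "computable_in n b"
  shows "decidable_in n (\<lambda>xs. P (a xs) (b xs))"
  using computable_in_subst2[of "\<lambda>x y. of_bool (P x y)"] assms by (simp add: decidable_in_def)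

lemma decidable_in_subst3:
  assumes "decidable_in 3 (\<lambda>xs. P (xs ! 0) (xs ! 1) (xs ! 2))"
    "computable_in n a" "computable_in n b" "computable_in n c"
  shows "decidable_in n (\<lambda>xs. P (a xs) (b xs) (c xs))"
  using computable_in_subst3[of "\<lambda>x y z. of_bool (P x y z)"] assms by (simp add: decidable_in_def)

lemma decidable_in_subst4:
  assumes "decidable_in 4 (\<lambda>xs. P (xs ! 0) (xs ! 1) (xs ! 2) (xs ! 3))"
    "computable_in n a" "computable_in n b" "computable_in n c" "computable_in n d"
  shows "decidable_in n (\<lambda>xs. P (a xs) (b xs) (c xs) (d xs))"
  using computable_in_subst4[of "\<lambda>x y z w. of_bool (P x y z w)"] assms by (simp add: decidable_in_def)

text \<open>Substitution for the outermost bound variable: \<open>f\<close> is composed with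
  \<open>m\<close> followed by the \<open>n\<close> projections, which reproduce the
  environment.\<close>

lemma computable_in_Cons:
  assumes "computable_in (Suc n) f" "computable_in n m"
  shows "computable_in n (\<lambda>xs. f (m xs # xs))"
proof -
  have "computable_in n (\<lambda>xs. f (map (\<lambda>g. g xs) (m # map (\<lambda>i xs. xs ! i) [0..<n])))"
    using assms by (intro computable_in_compose) (auto intro: computable_in_nth)
  moreover have "map (\<lambda>i. xs ! i) [0..<n] = xs" if "length xs = n" for xs :: "nat list"
    using map_nth[of xs] that by simp
  ultimately show ?thesis by (auto simp: comp_def elim: computable_in_cong)
qed

section \<open>Arithmetic by primitive recursion\<close>

lemma computable_in_Suc:
  assumes "computable_in n a" shows "computable_in n (\<lambda>xs. Suc (a xs))"
proof (rule computable_in_subst1[OF _ assms])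
  show "computable_in 1 (\<lambda>xs. Suc (xs ! 0))"
    unfolding computable_in_def
    by (rule exI[of _ Succ]) (auto simp: length_Suc_conv intro: evals_to.succ)
qed

lemma computable_in_const: "computable_in n (\<lambda>xs. c)"
proof (induction c)
  case 0
  show ?case unfolding computable_in_def by (blast intro: evals_to.zero)
next
  case (Suc c)
  then show ?case by (rule computable_in_Suc)
qed

text \<open>The constructor \<open>Prec\<close> hands the step program the counter, the previous
  value and then the parameters, hence the shape of the second premise. The recursion length is
  first the head of the list and is then replaced by \<open>m\<close>.\<close>

lemma computable_in_rec_nat:
  assumes b: "computable_in n b"
    and st: "computable_in (Suc (Suc n)) (\<lambda>ys. st (ys ! 0) (tl ys ! 0) (tl (tl ys)))"
    and m: "computable_in n m"
  shows "computable_in n (\<lambda>xs. rec_nat (b xs) (\<lambda>i y. st i y xs) (m xs))"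
proof -
  obtain p where p: "\<And>xs. length xs = n \<Longrightarrow> evals_to p xs (b xs)"
    using b unfolding computable_in_def by blast
  obtain q where q: "\<And>ys. length ys = Suc (Suc n) \<Longrightarrow>
      evals_to q ys (st (ys ! 0) (tl ys ! 0) (tl (tl ys)))"
    using st unfolding computable_in_def by blast
  have "evals_to (Prec p q) (i # xs) (rec_nat (b xs) (\<lambda>i y. st i y xs) i)"
    if "length xs = n" for i xs
  proof (induction i)
    case 0
    show ?case using p that by (auto intro: evals_to.prec_0)
  next
    case (Suc i)
    let ?y = "rec_nat (b xs) (\<lambda>i y. st i y xs) i"
    have "evals_to q (i # ?y # xs) (st i ?y xs)"
      using q[of "i # ?y # xs"] that by simp
    with Suc show ?case by (auto intro: evals_to.prec_Suc)
  qed
  then have "computable_in (Suc n) (\<lambda>ys. rec_nat (b (tl ys)) (\<lambda>i y. st i y (tl ys)) (ys ! 0))"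
    unfolding computable_in_def by (intro exI[of _ "Prec p q"]) (auto simp: length_Suc_conv)
  from computable_in_Cons[OF this m] show ?thesis by simp
qed

lemmas computable_in_vars =
  computable_in_nth computable_in_nth_tl computable_in_nth_tl2 computable_in_nth_tl3

lemma computable_in_pred:
  assumes "computable_in n a" shows "computable_in n (\<lambda>xs. a xs - 1)"
proof (rule computable_in_cong)
  show "computable_in n (\<lambda>xs. rec_nat 0 (\<lambda>i y. i) (a xs))"
    by (rule computable_in_rec_nat) (auto intro!: computable_in_vars computable_in_const assms)
  show "rec_nat 0 (\<lambda>i y. i) (a xs) = a xs - 1" for xs by (cases "a xs") auto
qed

lemma computable_in_diff:
  assumes "computable_in n a" "computable_in n b" shows "computable_in n (\<lambda>xs. a xs - b xs)"
proof (rule computable_in_cong)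
  show "computable_in n (\<lambda>xs. rec_nat (a xs) (\<lambda>i y. y - 1) (b xs))"
    by (rule computable_in_rec_nat)
      (auto intro!: computable_in_vars computable_in_pred[simplified] assms)
  have "rec_nat c (\<lambda>i y. y - 1) m = c - m" for c m :: nat by (induction m) auto
  then show "rec_nat (a xs) (\<lambda>i y. y - 1) (b xs) = a xs - b xs" for xs .
qed

lemma computable_in_add:
  assumes "computable_in n a" "computable_in n b" shows "computable_in n (\<lambda>xs. a xs + b xs)"
proof (rule computable_in_cong)
  show "computable_in n (\<lambda>xs. rec_nat (a xs) (\<lambda>i y. Suc y) (b xs))"
    by (rule computable_in_rec_nat) (auto intro!: computable_in_vars computable_in_Suc assms)
  have "rec_nat c (\<lambda>i y. Suc y) m = c + m" for c m :: nat by (induction m) auto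
  then show "rec_nat (a xs) (\<lambda>i y. Suc y) (b xs) = a xs + b xs" for xs .
qed

lemma computable_in_sum:
  assumes "computable_in (Suc n) (\<lambda>ys. f (ys ! 0) (tl ys))" "computable_in n m"
  shows "computable_in n (\<lambda>xs. \<Sum>i<m xs. f i xs)"
proof (rule computable_in_cong)
  \<comment> \<open>The recursion step carries the accumulator as second argument, which
    \<open>f\<close> does not expect; projections that skip this entry remove it.\<close>
  have "computable_in (Suc (Suc n)) (\<lambda>ys. (\<lambda>zs. f (zs ! 0) (tl zs))
      (map (\<lambda>g. g ys) ((\<lambda>ys. ys ! 0) # map (\<lambda>i ys. ys ! (i + 2)) [0..<n])))"
    using assms by (intro computable_in_compose) (auto intro: computable_in_nth)
  then have "computable_in (Suc (Suc n)) (\<lambda>ys. f (ys ! 0) (tl (tl ys)))"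
  proof (rule computable_in_cong)
    fix ys :: "nat list"
    assume "length ys = Suc (Suc n)"
    then have "map (\<lambda>i. ys ! (i + 2)) [0..<n] = tl (tl ys)"
      by (intro nth_equalityI) (auto simp: nth_tl)
    then show "(\<lambda>zs. f (zs ! 0) (tl zs))
        (map (\<lambda>g. g ys) ((\<lambda>ys. ys ! 0) # map (\<lambda>i ys. ys ! (i + 2)) [0..<n]))
      = f (ys ! 0) (tl (tl ys))"
      by (simp add: comp_def)
  qed
  then show "computable_in n (\<lambda>xs. rec_nat 0 (\<lambda>i y. y + f i xs) (m xs))"
    by (intro computable_in_rec_nat)
      (auto intro!: computable_in_vars computable_in_add computable_in_const assms)
  have "rec_nat 0 (\<lambda>i y. y + g i) c = (\<Sum>i<c. g i)" for c and g :: "nat \<Rightarrow> nat"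
    by (induction c) auto
  then show "rec_nat 0 (\<lambda>i y. y + f i xs) (m xs) = (\<Sum>i<m xs. f i xs)" for xs .
qed

lemma computable_in_mult:
  assumes "computable_in n a" "computable_in n b" shows "computable_in n (\<lambda>xs. a xs * b xs)"
proof (rule computable_in_subst2[OF _ assms])
  have "computable_in 2 (\<lambda>xs. \<Sum>i<xs ! 0. xs ! 1)"
    by (rule computable_in_sum) (auto intro!: computable_in_vars)
  then show "computable_in 2 (\<lambda>xs. xs ! 0 * xs ! 1)" by simp
qed

section \<open>Decidable predicates, bounded quantifiers and search\<close>

lemma decidable_in_le:
  assumes "computable_in n a" "computable_in n b" shows "decidable_in n (\<lambda>xs. a xs \<le> b xs)"
  unfolding decidable_in_def
proof (rule computable_in_cong)
  \<comment> \<open>Truncated subtraction: the outer difference is 1 exactly when the inner one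
    vanishes.\<close>
  show "computable_in n (\<lambda>xs. 1 - (a xs - b xs))"
    by (intro computable_in_diff computable_in_const assms)
qed auto

lemma decidable_in_not: "decidable_in n P \<Longrightarrow> decidable_in n (\<lambda>xs. \<not> P xs)"
  unfolding decidable_in_def
  by (rule computable_in_cong[OF computable_in_diff[OF computable_in_const[of n 1]]]) auto

lemma decidable_in_conj:
  assumes "decidable_in n P" "decidable_in n Q" shows "decidable_in n (\<lambda>xs. P xs \<and> Q xs)"
  using computable_in_mult[OF assms[unfolded decidable_in_def]]
  unfolding decidable_in_def by (simp add: of_bool_conj)

lemma decidable_in_disj:
  assumes "decidable_in n P" "decidable_in n Q" shows "decidable_in n (\<lambda>xs. P xs \<or> Q xs)"
proof -
  have "decidable_in n (\<lambda>xs. \<not> (\<not> P xs \<and> \<not> Q xs))"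
    by (intro decidable_in_not decidable_in_conj assms)
  then show ?thesis by simp
qed

lemma decidable_in_imp:
  assumes "decidable_in n P" "decidable_in n Q" shows "decidable_in n (\<lambda>xs. P xs \<longrightarrow> Q xs)"
proof -
  have "decidable_in n (\<lambda>xs. \<not> (P xs \<and> \<not> Q xs))"
    by (intro decidable_in_not decidable_in_conj assms)
  then show ?thesis by simp
qed

lemma decidable_in_less:
  assumes "computable_in n a" "computable_in n b" shows "decidable_in n (\<lambda>xs. a xs < b xs)"
  using decidable_in_not[OF decidable_in_le[OF assms(2,1)]] by (simp add: not_le)

lemma decidable_in_eq:
  assumes "computable_in n a" "computable_in n b" shows "decidable_in n (\<lambda>xs. a xs = b xs)"
proof -
  have "decidable_in n (\<lambda>xs. a xs \<le> b xs \<and> b xs \<le> a xs)"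
    by (intro decidable_in_conj decidable_in_le assms)
  then show ?thesis by (simp add: eq_iff)
qed

lemma computable_in_if:
  assumes "decidable_in n P" "computable_in n a" "computable_in n b"
  shows "computable_in n (\<lambda>xs. if P xs then a xs else b xs)"
proof (rule computable_in_cong)
  show "computable_in n (\<lambda>xs. of_bool (P xs) * a xs + of_bool (\<not> P xs) * b xs)"
    by (intro computable_in_add computable_in_mult computable_in_of_bool decidable_in_not assms)
qed auto

text \<open>A bounded count is a sum of characteristic values. Bounded quantifiers and division are
  derived from it.\<close>

lemma computable_in_card:
  assumes "decidable_in (Suc n) (\<lambda>ys. P (ys ! 0) (tl ys))" "computable_in n m"
  shows "computable_in n (\<lambda>xs. card {i. i < m xs \<and> P i xs})"
proof (rule computable_in_cong)
  show "computable_in n (\<lambda>xs. \<Sum>i<m xs. of_bool (P i xs))"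
    using assms by (intro computable_in_sum) (auto simp: decidable_in_def)
  show "(\<Sum>i<m xs. of_bool (P i xs)) = card {i. i < m xs \<and> P i xs}" for xs
    by (simp add: of_bool_def sum.If_cases Int_def flip: lessThan_def)
qed

lemma decidable_in_ex_less:
  assumes "decidable_in (Suc n) (\<lambda>ys. P (ys ! 0) (tl ys))" "computable_in n m"
  shows "decidable_in n (\<lambda>xs. \<exists>i<m xs. P i xs)"
proof -
  have "decidable_in n (\<lambda>xs. 0 < card {i. i < m xs \<and> P i xs})"
    by (intro decidable_in_less computable_in_card computable_in_const assms)
  then show ?thesis by (simp add: card_gt_0_iff)
qed

lemma decidable_in_all_less:
  assumes "decidable_in (Suc n) (\<lambda>ys. P (ys ! 0) (tl ys))" "computable_in n m"
  shows "decidable_in n (\<lambda>xs. \<forall>i<m xs. P i xs)"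
proof -
  have "decidable_in n (\<lambda>xs. \<not> (\<exists>i<m xs. \<not> P i xs))"
    by (intro decidable_in_not decidable_in_ex_less assms)
  then show ?thesis by simp
qed

lemma computable_in_Least:
  assumes P: "decidable_in (Suc n) (\<lambda>ys. P (ys ! 0) (tl ys))"
    and ex: "\<And>xs. length xs = n \<Longrightarrow> \<exists>i. P i xs"
  shows "computable_in n (\<lambda>xs. LEAST i. P i xs)"
proof -
  \<comment> \<open>\<open>Mu\<close> looks for a zero, so the characteristic function of the
    negation is searched; \<open>ex\<close> makes the search terminate.\<close>
  have "computable_in (Suc n) (\<lambda>ys. of_bool (\<not> P (ys ! 0) (tl ys)))"
    by (intro computable_in_of_bool decidable_in_not P)
  then obtain p where p: "\<And>ys. length ys = Suc n \<Longrightarrow> evals_to p ys (of_bool (\<not> P (ys ! 0) (tl ys)))"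
    unfolding computable_in_def by blast
  have "evals_to (Mu p) xs (LEAST i. P i xs)" if xs: "length xs = n" for xs
  proof (rule evals_to.mu)
    have "P (LEAST i. P i xs) xs" using ex[OF xs] by (rule LeastI_ex)
    then show "evals_to p ((LEAST i. P i xs) # xs) 0"
      using p[of "(LEAST i. P i xs) # xs"] xs by simp
    show "\<forall>i<LEAST i. P i xs. \<exists>y. evals_to p (i # xs) (Suc y)"
    proof (intro allI impI)
      fix i assume "i < (LEAST i. P i xs)"
      then have "\<not> P i xs" by (rule not_less_Least)
      then show "\<exists>y. evals_to p (i # xs) (Suc y)"
        using p[of "i # xs"] xs by (intro exI[of _ 0]) simp
    qed
  qed
  then show ?thesis unfolding computable_in_def by blast
qed

lemmas computable_intros =
  computable_in_vars computable_in_const computable_in_Suc computable_in_add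
  computable_in_mult computable_in_diff computable_in_if computable_in_sum computable_in_card
  decidable_in_le decidable_in_less decidable_in_eq decidable_in_not decidable_in_conj
  decidable_in_disj decidable_in_imp decidable_in_ex_less decidable_in_all_less

section \<open>Division and codes of finite sets and pairs\<close>

lemma div_eq_card:
  fixes x y :: nat
  assumes "y > 0"
  shows "x div y = card {i. i < x \<and> Suc i * y \<le> x}"
proof -
  \<comment> \<open>The quotient counts the positive multiples of \<open>y\<close> up to
    \<open>x\<close>; the condition \<open>i < x\<close> only makes the count bounded.\<close>
  have "Suc i * y \<le> x \<longleftrightarrow> i < x div y" for i
    using less_eq_div_iff_mult_less_eq[OF assms, of "Suc i" x] by (simp only: Suc_le_eq)
  moreover have "i < x" if "i < x div y" for i
    using that div_le_dividend[of x y] by linarith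
  ultimately have "{i. i < x \<and> Suc i * y \<le> x} = {..<x div y}" by blast
  then show ?thesis by simp
qed

lemma computable_in_div:
  assumes "computable_in n a" "computable_in n b" shows "computable_in n (\<lambda>xs. a xs div b xs)"
proof (rule computable_in_subst2[OF _ assms])
  have "computable_in 2 (\<lambda>xs. if xs ! 1 = 0 then 0
      else card {i. i < xs ! 0 \<and> Suc i * xs ! 1 \<le> xs ! 0})"
    by (intro computable_intros; simp)
  then show "computable_in 2 (\<lambda>xs. xs ! 0 div xs ! 1)"
    by (rule computable_in_cong) (simp add: div_eq_card)
qed

lemma computable_in_mod:
  assumes "computable_in n a" "computable_in n b" shows "computable_in n (\<lambda>xs. a xs mod b xs)"
proof -
  have "computable_in n (\<lambda>xs. a xs - b xs * (a xs div b xs))"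
    by (intro computable_intros computable_in_div assms)
  then show ?thesis by (simp add: minus_mult_div_eq_mod)
qed

lemma computable_in_funpow:
  assumes "computable_in 1 (\<lambda>xs. f (xs ! 0))" "computable_in n m" "computable_in n a"
  shows "computable_in n (\<lambda>xs. (f ^^ m xs) (a xs))"
proof (rule computable_in_cong)
  show "computable_in n (\<lambda>xs. rec_nat (a xs) (\<lambda>i y. f y) (m xs))"
    by (intro computable_in_rec_nat computable_in_subst1[OF assms(1)] computable_intros assms(2,3)) auto
  have "rec_nat c (\<lambda>i y. f y) m = (f ^^ m) c" for c m by (induction m) auto
  then show "rec_nat (a xs) (\<lambda>i y. f y) (m xs) = (f ^^ m xs) (a xs)" for xs .
qed

lemma computable_in_power2: 
  assumes "computable_in n a" shows "computable_in n (\<lambda>xs. 2 ^ a xs)"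
proof -
  have "computable_in n (\<lambda>xs. ((\<lambda>x. 2 * x) ^^ a xs) 1)"
    by (intro computable_in_funpow computable_intros assms) auto
  moreover have "((\<lambda>x. 2 * x) ^^ m) 1 = (2::nat) ^ m" for m by (induction m) auto
  ultimately show ?thesis by simp
qed

lemma decidable_in_set_decode:
  assumes "computable_in n a" "computable_in n b"
  shows "decidable_in n (\<lambda>xs. a xs \<in> set_decode (b xs))"
proof -
  have "decidable_in n (\<lambda>xs. b xs div 2 ^ a xs mod 2 = 1)"
    by (intro computable_intros computable_in_div computable_in_mod computable_in_power2 assms)
  then show ?thesis by (simp only: set_decode_def mem_Collect_eq odd_iff_mod_2_eq_one)
qed

lemma computable_in_set_encode_insert:
  assumes "computable_in n a" "computable_in n b"
  shows "computable_in n (\<lambda>xs. set_encode (insert (a xs) (set_decode (b xs))))"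
proof (rule computable_in_cong)
  \<comment> \<open>Inserting a new element sets a bit that was 0, which adds a power of two to the
    code.\<close>
  show "computable_in n (\<lambda>xs. if a xs \<in> set_decode (b xs) then b xs else b xs + 2 ^ a xs)"
    by (intro computable_intros decidable_in_set_decode computable_in_power2 assms)
qed (auto simp: set_encode_insert insert_absorb)

lemma computable_in_prod_encode:
  assumes "computable_in n a" "computable_in n b"
  shows "computable_in n (\<lambda>xs. prod_encode (a xs, b xs))"
proof -
  have "computable_in n (\<lambda>xs. (a xs + b xs) * Suc (a xs + b xs) div 2 + a xs)"
    by (intro computable_intros computable_in_div assms)
  then show ?thesis by (simp add: prod_encode_def triangle_def)
qed

text \<open>An element is the position of a nonzero bit of the code. This serves to bound
  quantifiers over members of coded sets.\<close>

lemma power2_le_if_mem_set_decode: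
  assumes "i \<in> set_decode n" shows "2 ^ i \<le> n"
proof -
  have "n div 2 ^ i \<noteq> 0" using assms by (auto simp: set_decode_def intro!: Nat.gr0I)
  then show ?thesis by (metis div_less leI)
qed

section \<open>Hall's condition\<close>

locale two_sided_graph =
  fixes A B :: "'a set" and adj :: "'a \<Rightarrow> 'a \<Rightarrow> bool"
  assumes disjoint: "A \<inter> B = {}"
    and sides: "adj x y \<Longrightarrow> x \<in> A \<and> y \<in> B \<or> x \<in> B \<and> y \<in> A"
    and adj_sym: "adj x y \<Longrightarrow> adj y x"
    and finite_adj: "finite {y. adj x y}"
begin

definition Nb :: "'a set \<Rightarrow> 'a set" where
  "Nb X = {y. \<exists>x\<in>X. adj x y}"

text \<open>Hall's condition on both sides after deletion of \<open>U\<close>, phrased in the full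
  graph so that \<open>U\<close> may vary while the locale stays fixed.\<close>

definition hall_without :: "'a set \<Rightarrow> bool" where
  "hall_without U \<longleftrightarrow> (\<forall>X. finite X \<and> (X \<subseteq> A \<or> X \<subseteq> B) \<and> X \<inter> U = {} \<longrightarrow> card X \<le> card (Nb X - U))"

lemma hall_withoutD:
  "hall_without U \<Longrightarrow> finite X \<Longrightarrow> X \<subseteq> A \<or> X \<subseteq> B \<Longrightarrow> X \<inter> U = {} \<Longrightarrow> card X \<le> card (Nb X - U)"
  by (simp add: hall_without_def)

lemma finite_Nb: "finite X \<Longrightarrow> finite (Nb X)"
proof -
  have "Nb X = (\<Union>x\<in>X. {y. adj x y})" by (auto simp: Nb_def)
  then show "finite X \<Longrightarrow> finite (Nb X)" using finite_adj by auto
qed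

lemma Nb_Un: "Nb (X \<union> Y) = Nb X \<union> Nb Y"
  by (auto simp: Nb_def)

lemma Nb_subset: "(X \<subseteq> A \<longrightarrow> Nb X \<subseteq> B) \<and> (X \<subseteq> B \<longrightarrow> Nb X \<subseteq> A)"
  using sides disjoint by (fastforce simp: Nb_def)

text \<open>Submodularity of the neighbourhood size makes tight sets closed under union and intersection.\<close>

lemma tight_Un_Int:
  assumes hall: "hall_without {}"
    and X: "finite X" "card (Nb X) = card X" and Y: "finite Y" "card (Nb Y) = card Y"
    and XY: "X \<union> Y \<subseteq> A \<or> X \<union> Y \<subseteq> B"
  shows "card (Nb (X \<union> Y)) = card (X \<union> Y)" "card (Nb (X \<inter> Y)) = card (X \<inter> Y)"
    "Nb (X \<inter> Y) = Nb X \<inter> Nb Y"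
proof -
  have sub: "Nb (X \<inter> Y) \<subseteq> Nb X \<inter> Nb Y" by (auto simp: Nb_def)
  have fin: "finite (Nb X \<inter> Nb Y)" using X finite_Nb by blast
  have 1: "card (X \<union> Y) \<le> card (Nb X \<union> Nb Y)"
    using hall_withoutD[OF hall, of "X \<union> Y"] X Y XY by (simp add: Nb_Un)
  have 2: "card (X \<inter> Y) \<le> card (Nb (X \<inter> Y))"
    using hall_withoutD[OF hall, of "X \<inter> Y"] X Y XY by auto
  have 3: "card (Nb (X \<inter> Y)) \<le> card (Nb X \<inter> Nb Y)"
    using sub fin by (rule card_mono[rotated])
  have 4: "card X + card Y = card (X \<union> Y) + card (X \<inter> Y)"
    using X Y by (intro card_Un_Int)
  have 5: "card (Nb X) + card (Nb Y) = card (Nb X \<union> Nb Y) + card (Nb X \<inter> Nb Y)"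
    using X Y by (intro card_Un_Int finite_Nb)
  \<comment> \<open>Facts 1 to 5 form a chain from \<open>card X + card Y\<close> to
    \<open>card (Nb X) + card (Nb Y)\<close>. Its ends agree by tightness, so every inequality in it
    is an equality.\<close>
  show "card (Nb (X \<union> Y)) = card (X \<union> Y)" "card (Nb (X \<inter> Y)) = card (X \<inter> Y)"
    using 1 2 3 4 5 X Y by (auto simp: Nb_Un)
  show "Nb (X \<inter> Y) = Nb X \<inter> Nb Y"
    using card_subset_eq[OF fin sub] 1 2 3 4 5 X Y by auto
qed

text \<open>
  Double counting: \<open>Nb (Y - Nb X)\<close> avoids \<open>X\<close> and \<open>x\<close>, while \<open>Nb (X - Nb Y)\<close> avoids \<open>Y\<close>, so Hall's
  condition for these two sets compares \<open>card (X \<inter> Nb Y)\<close> with \<open>card (Y \<inter> Nb X)\<close> in contradictory ways.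
\<close>

lemma tight_sets_cannot_block:
  assumes hall: "hall_without {}"
    and X: "finite X" "X \<subseteq> A" "card (Nb X) = card X" "x \<notin> X"
    and Y: "finite Y" "Y \<subseteq> B" "card (Nb Y) = card Y" "x \<in> Nb Y"
    and block: "\<And>y. adj x y \<Longrightarrow> y \<in> Nb X \<or> y \<notin> Y"
  shows False
proof -
  have fin: "finite (Nb X)" "finite (Nb Y)" using X Y finite_Nb by auto
  have cX: "card X = card (X - Nb Y) + card (X \<inter> Nb Y)"
    using X fin by (metis card_Diff_subset_Int card_mono finite_Int inf_le1 le_add_diff_inverse2)
  have cY: "card Y = card (Y - Nb X) + card (Y \<inter> Nb X)"
    using Y fin by (metis card_Diff_subset_Int card_mono finite_Int inf_le1 le_add_diff_inverse2)
  have cNX: "card (Nb X) = card (Nb X - Y) + card (Y \<inter> Nb X)"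
    using Y fin by (metis card_Diff_subset_Int card_mono finite_Int inf_le2 inf_commute le_add_diff_inverse2)
  have cNY: "card (Nb Y) = card (Nb Y - X) + card (X \<inter> Nb Y)"
    using X fin by (metis card_Diff_subset_Int card_mono finite_Int inf_le2 inf_commute le_add_diff_inverse2)
  have "card (X - Nb Y) \<le> card (Nb (X - Nb Y) - {})"
    by (rule hall_withoutD[OF hall]) (use X in auto)
  also have "\<dots> \<le> card (Nb X - Y)"
    by (rule card_mono) (use fin adj_sym in \<open>auto simp: Nb_def\<close>)
  finally have 1: "card (X - Nb Y) \<le> card (Nb X - Y)" .
  have "card (Y - Nb X) \<le> card (Nb (Y - Nb X) - {})"
    by (rule hall_withoutD[OF hall]) (use Y in auto)
  \<comment> \<open>By \<open>block\<close>, a neighbour of \<open>x\<close> in \<open>Y\<close>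
    lies in \<open>Nb X\<close>, so \<open>x\<close> is not in \<open>Nb (Y - Nb X)\<close>. As
    \<open>x\<close> does lie in \<open>Nb Y - X\<close>, the next inequality is strict.\<close>
  also have "\<dots> \<le> card (Nb Y - X - {x})"
    by (rule card_mono) (use fin adj_sym block in \<open>auto simp: Nb_def\<close>)
  also have "\<dots> < card (Nb Y - X)"
    by (rule card_Diff1_less) (use fin X Y in auto)
  finally have 2: "card (Y - Nb X) < card (Nb Y - X)" .
  show False using cX cY cNX cNY 1 2 X Y by linarith
qed

text \<open>If every neighbour \<open>y\<close> of \<open>x\<close> fails, each is blocked by a
  tight set in \<open>A\<close> that has \<open>y\<close> as a neighbour, or by a tight set in
  \<open>B\<close> that avoids \<open>y\<close> and has \<open>x\<close> as a neighbour. Uncrossing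
  merges the former into one set \<open>X\<close> and the latter into one set \<open>Y\<close>, and
  these two cannot block all neighbours.\<close>

lemma hall_without_neighbour_left:
  assumes hall: "hall_without {}" and x: "x \<in> A"
  shows "\<exists>y. adj x y \<and> hall_without {x, y}"
proof (rule ccontr)
  assume contra: "\<not> ?thesis"
  define N where "N = {y. adj x y}"
  have fN: "finite N" by (simp add: N_def finite_adj)
  define tight where "tight X \<longleftrightarrow> finite X \<and> card (Nb X) = card X" for X
  have bad: "(\<exists>X. tight X \<and> X \<subseteq> A \<and> x \<notin> X \<and> y \<in> Nb X) \<or> (\<exists>Y. tight Y \<and> Y \<subseteq> B \<and> y \<notin> Y \<and> x \<in> Nb Y)"
    if y: "adj x y" for y
  proof -
    have yB: "y \<in> B" using sides[OF y] x disjoint by blast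
    from contra y have "\<not> hall_without {x, y}" by blast
    then obtain X where X: "finite X" "X \<subseteq> A \<or> X \<subseteq> B" "X \<inter> {x, y} = {}"
      "card (Nb X - {x, y}) < card X"
      unfolding hall_without_def by (auto simp: not_le)
    have le: "card X \<le> card (Nb X)" using hall_withoutD[OF hall X(1,2)] by simp
    have fX: "finite (Nb X)" using X finite_Nb by blast
    from X(2) show ?thesis
    proof
      assume XA: "X \<subseteq> A"
      \<comment> \<open>The neighbourhood lies on one side, so deleting \<open>{x, y}\<close>
        removes at most one vertex; a violation forces that vertex to be present and
        \<open>X\<close> to be tight.\<close>
      then have eq: "Nb X - {x, y} = Nb X - {y}" using Nb_subset[of X] x disjoint by blast
      then have yX: "y \<in> Nb X" using X(4) le by (cases "y \<in> Nb X") auto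
      then have "card (Nb X) = card X" using X(4) le eq fX by (simp add: card_Diff_singleton)
      then show ?thesis using X XA yX by (auto simp: tight_def)
    next
      assume XB: "X \<subseteq> B"
      then have eq: "Nb X - {x, y} = Nb X - {x}" using Nb_subset[of X] yB disjoint by blast
      then have xX: "x \<in> Nb X" using X(4) le by (cases "x \<in> Nb X") auto
      then have "card (Nb X) = card X" using X(4) le eq fX by (simp add: card_Diff_singleton)
      then show ?thesis using X XB xX by (auto simp: tight_def)
    qed
  qed
  \<comment> \<open>Rather than joining all tight sets, one is taken that covers as many neighbours
    of \<open>x\<close> as possible; \<open>card N\<close> bounds this number.\<close>
  define P where "P X \<longleftrightarrow> tight X \<and> X \<subseteq> A \<and> x \<notin> X" for X
  have "P {}" by (simp add: P_def tight_def Nb_def)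
  moreover have "card (Nb X \<inter> N) \<le> card N" for X
    by (rule card_mono) (use fN in auto)
  ultimately obtain X where PX: "P X" and Xmax: "\<And>X'. P X' \<Longrightarrow> card (Nb X' \<inter> N) \<le> card (Nb X \<inter> N)"
    using ex_has_greatest_nat[of P "{}" "\<lambda>X. card (Nb X \<inter> N)" "Suc (card N)"]
    by (auto simp: less_Suc_eq_le)
  have inX: "y \<in> Nb X" if "P X'" "y \<in> Nb X'" "adj x y" for X' y
  proof -
    \<comment> \<open>Adjoining \<open>X'\<close> keeps the set tight, so by maximality it covers no
      further neighbour of \<open>x\<close>.\<close>
    have "card (Nb (X \<union> X')) = card (X \<union> X')"
      using PX that by (intro tight_Un_Int(1) hall) (auto simp: P_def tight_def)
    then have "P (X \<union> X')" using PX that by (auto simp: P_def tight_def)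
    then have "card (Nb (X \<union> X') \<inter> N) \<le> card (Nb X \<inter> N)" by (rule Xmax)
    then have "Nb X \<inter> N = Nb (X \<union> X') \<inter> N"
      by (intro card_seteq) (use fN Nb_Un in auto)
    then show ?thesis using that by (auto simp: Nb_Un N_def)
  qed
  define Q where "Q Y \<longleftrightarrow> tight Y \<and> Y \<subseteq> B \<and> x \<in> Nb Y" for Y
  show False
  proof (cases "\<exists>Y. Q Y")
    case True
    then obtain Y where QY: "Q Y" and Ymin: "\<And>Y'. Q Y' \<Longrightarrow> card Y \<le> card Y'"
      using ex_has_least_nat[of Q _ card] by blast
    have "y \<notin> Y" if "Q Y'" "y \<notin> Y'" for Y' y
    proof -
      \<comment> \<open>The equation for \<open>Nb (Y \<inter> Y')\<close> keeps \<open>x\<close> in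
        the neighbourhood of the intersection; minimality then puts \<open>Y\<close> inside every
        such \<open>Y'\<close>.\<close>
      have t: "card (Nb (Y \<inter> Y')) = card (Y \<inter> Y')" "Nb (Y \<inter> Y') = Nb Y \<inter> Nb Y'"
        using tight_Un_Int(2,3)[OF hall, of Y Y'] QY that by (auto simp: Q_def tight_def)
      then have "Q (Y \<inter> Y')" using QY that by (auto simp: Q_def tight_def)
      then have "card Y \<le> card (Y \<inter> Y')" by (rule Ymin)
      then have "Y \<inter> Y' = Y"
        using QY by (intro card_seteq) (auto simp: Q_def tight_def)
      then show ?thesis using that by blast
    qed
    then have "y \<in> Nb X \<or> y \<notin> Y" if "adj x y" for y
      using bad[OF that] inX that unfolding P_def Q_def by blast
    then show False
      using tight_sets_cannot_block[OF hall, of X x Y] PX QY by (auto simp: P_def Q_def tight_def)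
  next
    case False
    \<comment> \<open>Without blocking sets in \<open>B\<close>, the set \<open>X\<close> covers
      every neighbour of \<open>x\<close>, so inserting \<open>x\<close> enlarges \<open>X\<close>
      but not its neighbourhood.\<close>
    then have "y \<in> Nb X" if "adj x y" for y
      using bad[OF that] inX[OF _ _ that] unfolding P_def Q_def by blast
    then have "Nb (insert x X) = Nb X" by (auto simp: Nb_def)
    moreover have "card (insert x X) \<le> card (Nb (insert x X) - {})"
      by (rule hall_withoutD[OF hall]) (use PX x in \<open>auto simp: P_def tight_def\<close>)
    ultimately show False using PX by (auto simp: P_def tight_def)
  qed
qed

lemma two_sided_graph_swap: "two_sided_graph B A adj"
proof
  show "B \<inter> A = {}" using disjoint by blast
  show "x \<in> B \<and> y \<in> A \<or> x \<in> A \<and> y \<in> B" if "adj x y" for x y using sides[OF that] by blast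
qed (fact adj_sym finite_adj)+

lemma two_sided_graph_remove:
  "two_sided_graph (A - U) (B - U) (\<lambda>x y. adj x y \<and> x \<notin> U \<and> y \<notin> U)"
proof
  show "(A - U) \<inter> (B - U) = {}" using disjoint by blast
next
  fix x y assume "adj x y \<and> x \<notin> U \<and> y \<notin> U"
  then show "x \<in> A - U \<and> y \<in> B - U \<or> x \<in> B - U \<and> y \<in> A - U" and "adj y x \<and> y \<notin> U \<and> x \<notin> U"
    using sides[of x y] adj_sym[of x y] by blast+
next
  show "finite {y. adj x y \<and> x \<notin> U \<and> y \<notin> U}" for x
    by (rule finite_subset[OF _ finite_adj[of x]]) blast
qed

text \<open>The case \<open>x \<in> B\<close> follows by exchanging the sides, since
  \<open>hall_without\<close> is symmetric in them.\<close>

lemma hall_without_neighbour_empty: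
  assumes "hall_without {}" and "x \<in> A \<union> B"
  shows "\<exists>y. adj x y \<and> hall_without {x, y}"
proof -
  interpret swap: two_sided_graph B A adj by (rule two_sided_graph_swap)
  have swap: "swap.hall_without V \<longleftrightarrow> hall_without V" for V
    unfolding swap.hall_without_def hall_without_def by (simp only: disj_commute)
  from assms(2) show ?thesis
  proof
    assume "x \<in> A"
    with assms(1) show ?thesis by (rule hall_without_neighbour_left)
  next
    assume "x \<in> B"
    with assms(1) have "\<exists>y. adj x y \<and> swap.hall_without {x, y}"
      by (intro swap.hall_without_neighbour_left) (simp_all only: swap)
    then show ?thesis by (simp only: swap)
  qed
qed

text \<open>The case of no deleted vertices is applied to the graph with \<open>U\<close> removed,
  where deleting \<open>V\<close> amounts to deleting \<open>U \<union> V\<close> in the original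
  graph.\<close>

lemma hall_without_neighbour:
  assumes hall: "hall_without U" and x: "x \<in> (A \<union> B) - U"
  shows "\<exists>y. adj x y \<and> y \<notin> U \<and> hall_without (U \<union> {x, y})"
proof -
  interpret rem: two_sided_graph "A - U" "B - U" "\<lambda>x y. adj x y \<and> x \<notin> U \<and> y \<notin> U"
    by (rule two_sided_graph_remove)
  have Nb: "rem.Nb X = Nb X - U" if "X \<inter> U = {}" for X
    using that by (auto simp: rem.Nb_def Nb_def)
  have hall_iff: "rem.hall_without V \<longleftrightarrow> hall_without (U \<union> V)" for V
  proof -
    have Nb_eq: "rem.Nb X - V = Nb X - (U \<union> V)" if "X \<inter> (U \<union> V) = {}" for X
    proof -
      have "X \<inter> U = {}" using that by blast
      from Nb[OF this] show ?thesis by blast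
    qed
    have cond: "(X \<subseteq> A - U \<or> X \<subseteq> B - U) \<and> X \<inter> V = {} \<longleftrightarrow>
        (X \<subseteq> A \<or> X \<subseteq> B) \<and> X \<inter> (U \<union> V) = {}" for X
      by blast
    show ?thesis
      unfolding rem.hall_without_def hall_without_def
      by (simp only: cond, intro all_cong1 imp_cong refl, elim conjE, simp only: Nb_eq)
  qed
  have "rem.hall_without {}" using hall by (simp add: hall_iff)
  moreover have "x \<in> (A - U) \<union> (B - U)" using x by blast
  ultimately obtain y where "adj x y" "y \<notin> U" "rem.hall_without {x, y}"
    using rem.hall_without_neighbour_empty by blast
  then show ?thesis using hall_iff by blast
qed

end

section \<open>The greedy matching\<close>

text \<open>A matching is stored as the code of the set of codes of its (ordered) pairs.\<close>

definition matched :: "nat \<Rightarrow> nat \<Rightarrow> nat \<Rightarrow> bool" where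
  "matched T v w \<longleftrightarrow> prod_encode (v, w) \<in> set_decode T"

text \<open>The bound \<open>w < T\<close> makes the predicate decidable.\<close>

definition used :: "nat \<Rightarrow> nat \<Rightarrow> bool" where
  "used T v \<longleftrightarrow> (\<exists>w<T. matched T v w)"

definition add_pair :: "nat \<Rightarrow> nat \<Rightarrow> nat \<Rightarrow> nat" where
  "add_pair v w T = set_encode (insert (prod_encode (v, w)) (set_decode T))"

lemma matched_add_pair: "matched (add_pair v w T) a b \<longleftrightarrow> a = v \<and> b = w \<or> matched T a b"
  by (auto simp: matched_def add_pair_def)

lemma matched_0 [simp]: "\<not> matched 0 v w"
  by (simp add: matched_def)

text \<open>The code of a pair is at least its second component and less than the code of any set
  containing it, so the bound in \<open>used\<close> loses nothing.\<close>

lemma used_iff: "used T v \<longleftrightarrow> (\<exists>w. matched T v w)"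
proof -
  have "w < T" if "matched T v w" for w
    using power2_le_if_mem_set_decode[of "prod_encode (v, w)" T] le_prod_encode_2[of w v]
      less_exp[of "prod_encode (v, w)"] that
    unfolding matched_def by linarith
  then show ?thesis by (auto simp: used_def)
qed

lemma finite_used: "finite {v. used T v}"
proof (rule finite_subset)
  show "{v. used T v} \<subseteq> (fst \<circ> prod_decode) ` set_decode T"
    by (force simp: used_iff matched_def)
qed simp

section \<open>Hall's condition as a local test\<close>

locale expanding_graph = two_sided_graph A B adj for A B :: "nat set" and adj +
  fixes G h :: "nat \<Rightarrow> nat"
  assumes le_G: "n \<le> G n"
    and less_G: "adj i j \<Longrightarrow> i < n \<Longrightarrow> j < G n"
    and h_0: "h 0 = 0"
    and expanding: "finite X \<Longrightarrow> X \<subseteq> A \<or> X \<subseteq> B \<Longrightarrow> h n \<le> card X \<Longrightarrow> card X + n \<le> card (Nb X)"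
begin

lemma hall: "hall_without {}"
  using expanding[of _ 0] h_0 by (auto simp: hall_without_def)

text \<open>
  A violating set is tight for \<open>U\<close> and hence small. Cutting it off at the radii \<open>(G ^^ m) r\<close> must
  become stationary after few steps; the part cut off is then a component of the violating set,
  and is itself violating.
\<close>

lemma hall_without_if_local:
  assumes hall: "hall_without U" and U: "finite U" "card U \<le> c"
    and xy: "adj x y" "x \<notin> U" "y \<notin> U" "x < r" "y < r"
    and local: "\<And>X. X \<subseteq> {..<(G ^^ (2 * h (Suc c))) r} \<Longrightarrow> X \<subseteq> A \<or> X \<subseteq> B \<Longrightarrow> X \<inter> (U \<union> {x, y}) = {}
      \<Longrightarrow> card X \<le> card (Nb X - (U \<union> {x, y}))"
  shows "hall_without (U \<union> {x, y})"
proof (rule ccontr)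
  define L where "L = h (Suc c)"
  assume "\<not> ?thesis"
  then obtain X where X: "finite X" "X \<subseteq> A \<or> X \<subseteq> B" "X \<inter> (U \<union> {x, y}) = {}"
    and viol: "card (Nb X - (U \<union> {x, y})) < card X"
    unfolding hall_without_def by (auto simp: not_le)
  have fin: "finite (Nb X)" using X finite_Nb by blast
  have le: "card X \<le> card (Nb X - U)"
    using hall_withoutD[OF hall X(1,2)] X(3) by blast
  \<comment> \<open>\<open>x\<close> and \<open>y\<close> lie on opposite sides and
    \<open>Nb X\<close> on one, so deleting both removes at most one vertex \<open>z\<close>; the
    violation then makes \<open>X\<close> tight for \<open>U\<close>.\<close>
  have "\<not> {x, y} \<subseteq> Nb X"
    using X(2) Nb_subset[of X] sides[OF xy(1)] disjoint by blast
  then have "\<exists>z \<in> {x, y}. Nb X - (U \<union> {x, y}) = (Nb X - U) - {z}" by blast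
  then obtain z where z: "z \<in> {x, y}" "Nb X - (U \<union> {x, y}) = (Nb X - U) - {z}" by blast
  have zX: "z \<in> Nb X" "z \<notin> U"
    using viol le z xy by (cases "z \<in> Nb X", auto)
  have tight: "card (Nb X - U) = card X"
    using viol le unfolding z(2) using zX fin by (simp add: card_Diff_singleton)
  \<comment> \<open>A surplus of \<open>Suc c\<close> cannot be used up by at most \<open>c\<close>
    deleted vertices.\<close>
  have small: "card X < L"
  proof (rule ccontr)
    assume "\<not> card X < L"
    then have "card X + Suc c \<le> card (Nb X)"
      using expanding[OF X(1,2), of "Suc c"] by (simp add: L_def not_less)
    moreover have "card (Nb X) - card U \<le> card (Nb X - U)"
      using U(1) by (rule diff_card_le_card_Diff)
    ultimately show False using tight U(2) by linarith
  qed
  define Y where "Y m = X \<inter> {..<(G ^^ m) r}" for m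
  have Y_mono: "Y m \<subseteq> Y (Suc m)" for m
    using le_G[of "(G ^^ m) r"] by (auto simp: Y_def)
  have finY: "finite (Y m)" for m using X(1) by (simp add: Y_def)
  \<comment> \<open>Radii advance two steps at a time because vertices with a common neighbour are
    two steps apart. Growth in each of \<open>L\<close> rounds would give at least \<open>L\<close>
    elements, too many for \<open>X\<close>.\<close>
  have "\<exists>i<L. Y (2 * i) = Y (2 * Suc i)"
  proof (rule ccontr)
    assume no: "\<not> ?thesis"
    have "i \<le> card (Y (2 * i))" if "i \<le> L" for i
      using that
    proof (induction i)
      case (Suc i)
      have "Y (2 * i) \<subseteq> Y (2 * Suc i)" using Y_mono[of "2 * i"] Y_mono[of "Suc (2 * i)"] by simp
      moreover have "Y (2 * i) \<noteq> Y (2 * Suc i)" using no Suc.prems by auto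
      ultimately have "card (Y (2 * i)) < card (Y (2 * Suc i))"
        using finY by (intro psubset_card_mono) auto
      then show ?case using Suc by simp
    qed simp
    then have "L \<le> card (Y (2 * L))" by simp
    also have "\<dots> \<le> card X" using X(1) by (intro card_mono) (auto simp: Y_def)
    finally show False using small by simp
  qed
  then obtain i where i: "i < L" and stat: "Y (2 * i) = Y (2 * Suc i)" by blast
  define Z where "Z = Y (2 * i)"
  have ZX: "Z \<subseteq> X" by (auto simp: Z_def Y_def)
  have grow: "(G ^^ a) r \<le> (G ^^ b) r" if "a \<le> b" for a b
    using that
  proof (induction rule: dec_induct)
    case (step n)
    then show ?case using le_G[of "(G ^^ n) r"] by simp
  qed simp
  have ZR: "Z \<subseteq> {..<(G ^^ (2 * h (Suc c))) r}"
    using grow[of "2 * i" "2 * L"] i by (auto simp: Z_def Y_def L_def)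
  have closed: "w \<in> Z" if "v \<in> Z" "adj v u" "adj w u" "w \<in> X" for u v w
  proof -
    have "u < (G ^^ Suc (2 * i)) r" using that less_G[of v u] by (auto simp: Z_def Y_def)
    then have "w < (G ^^ (2 * Suc i)) r" using less_G[of u w] that adj_sym by simp
    then show ?thesis using that stat by (auto simp: Z_def Y_def)
  qed
  \<comment> \<open>This includes \<open>i = 0\<close>: a neighbour of \<open>z\<close> in
    \<open>X\<close> lies below \<open>G r\<close>, hence in \<open>Y (2 * Suc i)\<close>, which
    equals \<open>Z\<close>.\<close>
  have zZ: "z \<in> Nb Z"
  proof -
    obtain w where w: "w \<in> X" "adj w z" using zX by (auto simp: Nb_def)
    have "z < (G ^^ 0) r" using z xy by auto
    then have "w < (G ^^ 1) r" using less_G[of z w] w adj_sym by simp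
    also have "\<dots> \<le> (G ^^ (2 * Suc i)) r" by (rule grow) simp
    finally have "w \<in> Z" using w stat by (auto simp: Z_def Y_def)
    then show ?thesis using w by (auto simp: Nb_def)
  qed
  have split: "Nb X - U = (Nb Z - U) \<union> (Nb (X - Z) - U)"
    using ZX by (auto simp: Nb_def)
  \<comment> \<open>By \<open>closed\<close>, \<open>Z\<close> and \<open>X - Z\<close> share no
    neighbour, so the sizes add up. As \<open>X\<close> is tight and \<open>X - Z\<close> satisfies
    Hall's condition, \<open>Z\<close> has no surplus to make up for the loss of
    \<open>z\<close>.\<close>
  have "(Nb Z - U) \<inter> (Nb (X - Z) - U) = {}"
    using closed by (auto simp: Nb_def)
  then have "card (Nb X - U) = card (Nb Z - U) + card (Nb (X - Z) - U)"
    unfolding split using ZX X(1) by (intro card_Un_disjoint) (auto intro: finite_Nb finite_subset)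
  moreover have "card (X - Z) \<le> card (Nb (X - Z) - U)"
    using X by (intro hall_withoutD[OF hall]) auto
  moreover have "card X = card Z + card (X - Z)"
    using ZX X(1) by (metis card_Diff_subset card_mono finite_subset le_add_diff_inverse)
  ultimately have "card (Nb Z - U) \<le> card Z" using tight by linarith
  moreover have "card (Nb Z - (U \<union> {x, y})) < card (Nb Z - U)"
  proof (rule psubset_card_mono)
    show "finite (Nb Z - U)" using ZX X(1) by (auto intro: finite_Nb finite_subset)
    show "Nb Z - (U \<union> {x, y}) \<subset> Nb Z - U" using zZ zX z by blast
  qed
  moreover have "card Z \<le> card (Nb Z - (U \<union> {x, y}))"
    using local[OF ZR] ZX X by blast
  ultimately show False by linarith
qed

text \<open>The local hypothesis of \<open>hall_without_if_local\<close> in bounded form: sets are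
  given by codes below \<open>2 ^ R\<close> and neighbours are sought below \<open>G R\<close>, so
  that decidability follows from the closure rules.\<close>

definition local_hall :: "nat \<Rightarrow> nat \<Rightarrow> nat \<Rightarrow> nat \<Rightarrow> bool" where
  "local_hall T x y R \<longleftrightarrow> (\<forall>c<2 ^ R.
     ((\<forall>i<R. i \<in> set_decode c \<longrightarrow> i \<in> A) \<or> (\<forall>i<R. i \<in> set_decode c \<longrightarrow> i \<in> B)) \<and>
     (\<forall>i<R. i \<in> set_decode c \<longrightarrow> \<not> used T i \<and> i \<noteq> x \<and> i \<noteq> y) \<longrightarrow>
     card {i. i < R \<and> i \<in> set_decode c} \<le>
     card {j. j < G R \<and> (\<exists>i<R. i \<in> set_decode c \<and> adj i j) \<and> \<not> used T j \<and> j \<noteq> x \<and> j \<noteq> y})"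

text \<open>The codes below \<open>2 ^ R\<close> run over exactly the subsets of
  \<open>{..<R}\<close>, and by \<open>less_G\<close> the bound \<open>G R\<close> misses no
  neighbour.\<close>

lemma local_hall_iff:
  "local_hall T x y R \<longleftrightarrow> (\<forall>X. X \<subseteq> {..<R} \<longrightarrow> X \<subseteq> A \<or> X \<subseteq> B \<longrightarrow> X \<inter> ({v. used T v} \<union> {x, y}) = {} \<longrightarrow>
     card X \<le> card (Nb X - ({v. used T v} \<union> {x, y})))" (is "_ \<longleftrightarrow> (\<forall>X. _ \<longrightarrow> ?P X)")
proof -
  let ?Q = "\<lambda>X. ((\<forall>i<R. i \<in> X \<longrightarrow> i \<in> A) \<or> (\<forall>i<R. i \<in> X \<longrightarrow> i \<in> B)) \<and>
     (\<forall>i<R. i \<in> X \<longrightarrow> \<not> used T i \<and> i \<noteq> x \<and> i \<noteq> y) \<longrightarrow>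
     card {i. i < R \<and> i \<in> X} \<le>
     card {j. j < G R \<and> (\<exists>i<R. i \<in> X \<and> adj i j) \<and> \<not> used T j \<and> j \<noteq> x \<and> j \<noteq> y}"
  have PQ: "?P X \<longleftrightarrow> ?Q X" if X: "X \<subseteq> {..<R}" for X
  proof -
    have "{i. i < R \<and> i \<in> X} = X" using X by auto
    moreover have "{j. j < G R \<and> (\<exists>i<R. i \<in> X \<and> adj i j) \<and> \<not> used T j \<and> j \<noteq> x \<and> j \<noteq> y}
        = Nb X - ({v. used T v} \<union> {x, y})"
      using X less_G by (auto simp: Nb_def)
    moreover have "(\<forall>i<R. i \<in> X \<longrightarrow> i \<in> C) \<longleftrightarrow> X \<subseteq> C" for C using X by auto
    moreover have "(\<forall>i<R. i \<in> X \<longrightarrow> \<not> used T i \<and> i \<noteq> x \<and> i \<noteq> y) \<longleftrightarrow>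
        X \<inter> ({v. used T v} \<union> {x, y}) = {}" using X by auto
    ultimately show ?thesis using X by (simp only:) blast
  qed
  have "local_hall T x y R \<longleftrightarrow> (\<forall>c<2 ^ R. ?Q (set_decode c))" by (simp only: local_hall_def)
  also have "\<dots> \<longleftrightarrow> (\<forall>X. X \<subseteq> {..<R} \<longrightarrow> ?Q X)"
  proof (rule iffI; rule allI; rule impI)
    fix X assume all: "\<forall>c<2 ^ R. ?Q (set_decode c)" and X: "X \<subseteq> {..<R}"
    then have fX: "finite X" by (rule_tac finite_subset) auto
    have "set_encode X \<le> set_encode {..<R}"
      using X by (intro subset_decode_imp_le) (auto simp: fX)
    also have "\<dots> < 2 ^ R"
      by (induction R) (auto simp: set_encode_def lessThan_Suc)
    finally have "?Q (set_decode (set_encode X))" by (rule all[THEN spec, THEN mp])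
    then show "?Q X" by (simp only: set_encode_inverse[OF fX])
  next
    fix c assume all: "\<forall>X. X \<subseteq> {..<R} \<longrightarrow> ?Q X" and c: "c < (2::nat) ^ R"
    have "set_decode c \<subseteq> {..<R}"
    proof
      fix i assume "i \<in> set_decode c"
      then have "(2::nat) ^ i < 2 ^ R"
        using power2_le_if_mem_set_decode[of i c] c by linarith
      then show "i \<in> {..<R}" by simp
    qed
    then show "?Q (set_decode c)" using all by blast
  qed
  also have "\<dots> \<longleftrightarrow> (\<forall>X. X \<subseteq> {..<R} \<longrightarrow> ?P X)"
    by (rule all_cong1, rule imp_cong[OF refl], rule PQ[symmetric])
  finally show ?thesis .
qed

end

section \<open>The stages and their invariant\<close>

context expanding_graph
begin

text \<open>The radius of \<open>hall_without_if_local\<close> for \<open>c = 2 * s\<close>, since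
  each stage before \<open>s\<close> uses at most two vertices; \<open>Suc (s + y)\<close> exceeds
  both endpoints of the edge.\<close>

definition radius :: "nat \<Rightarrow> nat \<Rightarrow> nat" where
  "radius s y = (G ^^ (2 * h (Suc (2 * s)))) (Suc (s + y))"

definition admissible :: "nat \<Rightarrow> nat \<Rightarrow> nat \<Rightarrow> bool" where
  "admissible T s y \<longleftrightarrow> adj s y \<and> \<not> used T y \<and> local_hall T s y (radius s y)"

text \<open>The alternative \<open>y = G (Suc s)\<close> only keeps the search total on unreachable states.\<close>

definition choice :: "nat \<Rightarrow> nat \<Rightarrow> nat" where
  "choice T s = (LEAST y. y = G (Suc s) \<or> admissible T s y)"

text \<open>Both orientations are stored, so that \<open>used\<close> and \<open>partner\<close>
  need only look at first components.\<close>

definition stage :: "nat \<Rightarrow> nat \<Rightarrow> nat" where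
  "stage s T = (if (s \<in> A \<or> s \<in> B) \<and> \<not> used T s
     then add_pair s (choice T s) (add_pair (choice T s) s T) else T)"

definition state :: "nat \<Rightarrow> nat" where
  "state n = rec_nat 0 stage n"

lemma state_simps [simp]: "state 0 = 0" "state (Suc n) = stage n (state n)"
  by (simp_all add: state_def)

text \<open>The bound \<open>2 * s\<close> is the one built into \<open>radius\<close>, and Hall's
  condition guarantees that the next stage finds a neighbour.\<close>

definition invariant :: "nat \<Rightarrow> nat \<Rightarrow> bool" where
  "invariant s T \<longleftrightarrow>
     (\<forall>v w. matched T v w \<longrightarrow> adj v w \<and> matched T w v) \<and>
     (\<forall>v w w'. matched T v w \<longrightarrow> matched T v w' \<longrightarrow> w = w') \<and>
     card {v. used T v} \<le> 2 * s \<and> hall_without {v. used T v} \<and>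
     (\<forall>v<s. v \<in> A \<union> B \<longrightarrow> used T v)"

text \<open>Some neighbour preserves Hall's condition and therefore passes the local test. It lies
  below \<open>G (Suc s)\<close>, so the search stops before reaching the default value.\<close>

lemma admissible_choice:
  assumes inv: "invariant s T" and s: "s \<in> A \<union> B" "\<not> used T s"
  shows "admissible T s (choice T s)"
proof -
  have "\<exists>y. adj s y \<and> y \<notin> {v. used T v} \<and> hall_without ({v. used T v} \<union> {s, y})"
    by (rule hall_without_neighbour) (use inv s in \<open>auto simp: invariant_def\<close>)
  then obtain y where y: "adj s y" "y \<notin> {v. used T v}" "hall_without ({v. used T v} \<union> {s, y})"
    by blast
  have "local_hall T s y (radius s y)"
    unfolding local_hall_iff
  proof (intro allI impI)
    fix X assume X: "X \<subseteq> {..<radius s y}" "X \<subseteq> A \<or> X \<subseteq> B" "X \<inter> ({v. used T v} \<union> {s, y}) = {}"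
    have "finite X" using X(1) by (rule finite_subset) simp
    then show "card X \<le> card (Nb X - ({v. used T v} \<union> {s, y}))"
      using y(3) X(2,3) by (intro hall_withoutD)
  qed
  then have adm: "admissible T s y" using y by (simp add: admissible_def)
  have "choice T s \<le> y" unfolding choice_def using adm by (intro Least_le) simp
  also have "y < G (Suc s)" using y by (intro less_G) auto
  finally have "choice T s \<noteq> G (Suc s)" by simp
  moreover have "choice T s = G (Suc s) \<or> admissible T s (choice T s)"
    unfolding choice_def by (rule LeastI[of _ y]) (use adm in simp)
  ultimately show ?thesis by simp
qed

lemma matched_stage: "matched T v w \<Longrightarrow> matched (stage s T) v w"
  by (simp add: stage_def matched_add_pair)

lemma invariant_stage:
  assumes inv: "invariant s T" shows "invariant (Suc s) (stage s T)"
proof (cases "s \<in> A \<union> B \<and> \<not> used T s")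
  case False
  then have "stage s T = T" by (auto simp: stage_def)
  then show ?thesis using inv False by (auto simp: invariant_def less_Suc_eq)
next
  case True
  define y where "y = choice T s"
  have "admissible T s y" using admissible_choice[OF inv] True by (simp add: y_def)
  then have y: "adj s y" "\<not> used T y" "local_hall T s y (radius s y)"
    by (auto simp: admissible_def)
  have matched: "matched (stage s T) v w \<longleftrightarrow> v = s \<and> w = y \<or> v = y \<and> w = s \<or> matched T v w" for v w
    using True by (auto simp: stage_def matched_add_pair y_def)
  have used: "{v. used (stage s T) v} = {v. used T v} \<union> {s, y}"
    by (auto simp: used_iff matched)
  have "card ({v. used T v} \<union> {s, y}) \<le> card {v. used T v} + card {s, y}"
    by (rule card_Un_le)
  also have "\<dots> \<le> 2 * Suc s"
    using inv card_insert_le_m1[of 2 "{y}" s] by (simp add: invariant_def)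
  finally have "card {v. used (stage s T) v} \<le> 2 * Suc s" by (simp only: used)
  \<comment> \<open>The local test passed by \<open>y\<close> yields the global condition, with
    \<open>c = 2 * s\<close> and \<open>r = Suc (s + y)\<close>.\<close>
  moreover have "hall_without {v. used (stage s T) v}"
    unfolding used
  proof (rule hall_without_if_local)
    show "hall_without {v. used T v}" "card {v. used T v} \<le> 2 * s"
      using inv by (simp_all add: invariant_def)
    show "card X \<le> card (Nb X - ({v. used T v} \<union> {s, y}))"
      if "X \<subseteq> {..<(G ^^ (2 * h (Suc (2 * s)))) (Suc (s + y))}" "X \<subseteq> A \<or> X \<subseteq> B"
        "X \<inter> ({v. used T v} \<union> {s, y}) = {}" for X
      using y(3) that unfolding local_hall_iff radius_def by blast
  qed (use y True finite_used in auto)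
  moreover have "used (stage s T) v" if "v < Suc s" "v \<in> A \<union> B" for v
  proof -
    have "v \<in> {v. used T v} \<union> {s, y}"
      using that inv by (auto simp: invariant_def less_Suc_eq)
    then show ?thesis using used by blast
  qed
  moreover have "adj v w \<and> matched (stage s T) w v" if "matched (stage s T) v w" for v w
    using that inv y(1) adj_sym[OF y(1)] unfolding matched invariant_def by blast
  moreover have "w = w'" if "matched (stage s T) v w" "matched (stage s T) v w'" for v w w'
  proof -
    have "\<not> matched T s u" "\<not> matched T y u" for u
      using True y(2) by (auto simp: used_iff)
    moreover have "s \<noteq> y" using y(1) sides disjoint by blast
    ultimately show ?thesis
      using that inv unfolding matched invariant_def by blast
  qed
  ultimately show ?thesis unfolding invariant_def by blast
qed

lemma invariant_state: "invariant n (state n)"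
proof (induction n)
  case 0
  show ?case using hall by (simp add: invariant_def used_iff)
qed (simp add: invariant_stage)

lemma matched_state_mono: "matched (state m) v w \<Longrightarrow> m \<le> n \<Longrightarrow> matched (state n) v w"
  by (rotate_tac, induction rule: dec_induct) (auto intro: matched_stage)

text \<open>Stage \<open>v\<close> settles the vertex \<open>v\<close> and later stages never undo a
  pair, so the limit matching can be read off from \<open>state (Suc v)\<close>.\<close>

definition partner :: "nat \<Rightarrow> nat \<Rightarrow> bool" where
  "partner v w \<longleftrightarrow> matched (state (Suc v)) v w"

lemma matched_state_unique:
  assumes "matched (state m) v w" "matched (state n) v w'" shows "w = w'"
proof -
  have "matched (state (max m n)) v w" "matched (state (max m n)) v w'"
    using assms matched_state_mono by (meson max.cobounded1 max.cobounded2)+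
  then show ?thesis using invariant_state[of "max m n"] unfolding invariant_def by blast
qed

lemma partner_adj: "partner v w \<Longrightarrow> adj v w"
  using invariant_state unfolding partner_def invariant_def by blast

lemma partner_unique: "partner v w \<Longrightarrow> partner v w' \<Longrightarrow> w = w'"
  unfolding partner_def by (rule matched_state_unique)

lemma partner_exists:
  assumes "v \<in> A \<union> B" shows "\<exists>w. partner v w"
proof -
  have "used (state (Suc v)) v" using invariant_state[of "Suc v"] assms by (auto simp: invariant_def)
  then show ?thesis by (simp add: used_iff partner_def)
qed

text \<open>The reversed pair lies in \<open>state (Suc v)\<close>, whereas \<open>partner w\<close>
  consults \<open>state (Suc w)\<close>; uniqueness across states identifies the two values.\<close>

lemma partner_sym:
  assumes "partner v w" shows "partner w v"
proof -
  have "w \<in> A \<union> B" using sides[OF partner_adj[OF assms]] by blast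
  then obtain v' where v': "partner w v'" using partner_exists by blast
  have "matched (state (Suc v)) w v"
    using assms invariant_state[of "Suc v"] by (auto simp: partner_def invariant_def)
  then have "v' = v" using v' unfolding partner_def by (rule matched_state_unique[rotated])
  then show ?thesis using v' by simp
qed

end

section \<open>Computability of the greedy matching\<close>

lemma decidable_in_matched:
  assumes "computable_in n a" "computable_in n b" "computable_in n c"
  shows "decidable_in n (\<lambda>xs. matched (a xs) (b xs) (c xs))"
  unfolding matched_def by (intro decidable_in_set_decode computable_in_prod_encode assms)

lemma decidable_in_used:
  assumes "computable_in n a" "computable_in n b"
  shows "decidable_in n (\<lambda>xs. used (a xs) (b xs))"
proof (rule decidable_in_subst2[OF _ assms])
  show "decidable_in 2 (\<lambda>xs. used (xs ! 0) (xs ! 1))"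
    unfolding used_def by (intro computable_intros decidable_in_matched; simp)
qed

lemma computable_in_add_pair:
  assumes "computable_in n a" "computable_in n b" "computable_in n c"
  shows "computable_in n (\<lambda>xs. add_pair (a xs) (b xs) (c xs))"
  unfolding add_pair_def by (intro computable_in_set_encode_insert computable_in_prod_encode assms)

locale computable_expanding_graph = expanding_graph +
  assumes dec_A: "decidable_in 1 (\<lambda>xs. xs ! 0 \<in> A)"
    and dec_B: "decidable_in 1 (\<lambda>xs. xs ! 0 \<in> B)"
    and dec_adj: "decidable_in 2 (\<lambda>xs. adj (xs ! 0) (xs ! 1))"
    and comp_G: "computable_in 1 (\<lambda>xs. G (xs ! 0))"
    and comp_h: "computable_in 1 (\<lambda>xs. h (xs ! 0))"
begin

lemmas graph_intros = computable_intros decidable_in_used decidable_in_set_decode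
  decidable_in_subst1[OF dec_A] decidable_in_subst1[OF dec_B] decidable_in_subst2[OF dec_adj]
  computable_in_subst1[OF comp_G] computable_in_subst1[OF comp_h] computable_in_power2

lemma decidable_local_hall:
  "decidable_in 4 (\<lambda>xs. local_hall (xs ! 0) (xs ! 1) (xs ! 2) (xs ! 3))"
  unfolding local_hall_def by (intro graph_intros; simp)

lemma computable_radius: "computable_in 2 (\<lambda>xs. radius (xs ! 0) (xs ! 1))"
  unfolding radius_def by (intro computable_in_funpow[OF comp_G] graph_intros; simp)

lemma decidable_admissible:
  "decidable_in 3 (\<lambda>xs. admissible (xs ! 0) (xs ! 1) (xs ! 2))"
  unfolding admissible_def
  by (intro graph_intros decidable_in_subst4[OF decidable_local_hall]
      computable_in_subst2[OF computable_radius]; simp)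

lemma computable_choice: "computable_in 2 (\<lambda>xs. choice (xs ! 0) (xs ! 1))"
  unfolding choice_def
  by (intro computable_in_Least graph_intros decidable_in_subst3[OF decidable_admissible]; ((simp; fail) | blast))

lemma computable_stage: "computable_in 2 (\<lambda>xs. stage (xs ! 0) (xs ! 1))"
  unfolding stage_def
  by (intro graph_intros computable_in_add_pair computable_in_subst2[OF computable_choice]; simp)

lemma computable_state: "computable_in 1 (\<lambda>xs. state (xs ! 0))"
  unfolding state_def
  by (intro computable_in_rec_nat computable_in_subst2[OF computable_stage] graph_intros; simp)

lemma decidable_partner: "decidable_in 2 (\<lambda>xs. partner (xs ! 0) (xs ! 1))"
  unfolding partner_def
  by (intro decidable_in_matched computable_in_subst1[OF computable_state] graph_intros; simp)

end

section \<open>Harem matchings\<close>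

lemma all_length_1: "(\<forall>xs. length xs = 1 \<longrightarrow> P xs) \<longleftrightarrow> (\<forall>x. P [x])"
  by (auto simp: length_Suc_conv)

lemma all_length_2: "(\<forall>xs. length xs = 2 \<longrightarrow> P xs) \<longleftrightarrow> (\<forall>x y. P [x, y])"
  by (auto simp: length_Suc_conv numeral_2_eq_2)

lemma computable_fun_iff: "computable_fun f \<longleftrightarrow> computable_in 1 (\<lambda>xs. f (xs ! 0))"
  by (simp add: computable_fun_def computable_in_def all_length_1 del: One_nat_def)

lemma computable_set_iff: "computable_set S \<longleftrightarrow> decidable_in 1 (\<lambda>xs. xs ! 0 \<in> S)"
  by (simp add: computable_set_def decidable_in_def computable_in_def all_length_1 of_bool_def
      del: One_nat_def)

lemma computable_rel_iff: "computable_rel R \<longleftrightarrow> decidable_in 2 (\<lambda>xs. (xs ! 0, xs ! 1) \<in> R)"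
  by (simp add: computable_rel_def decidable_in_def computable_in_def all_length_2 of_bool_def)

section \<open>Splitting vertices into copies\<close>

locale harem_graph = two_sided_graph A B adj for A B :: "nat set" and adj +
  fixes k :: nat and G h :: "nat \<Rightarrow> nat"
  assumes k: "k \<ge> 1"
    and le_G: "n \<le> G n"
    and less_G: "adj i j \<Longrightarrow> i < n \<Longrightarrow> j < G n"
    and h_0: "h 0 = 0"
    and expanding_A: "finite X \<Longrightarrow> X \<subseteq> A \<Longrightarrow> h n \<le> card X \<Longrightarrow> k * card X + n \<le> card (Nb X)"
    and expanding_B: "finite X \<Longrightarrow> X \<subseteq> B \<Longrightarrow> h n \<le> card X \<Longrightarrow> card X + k * n \<le> k * card (Nb X)"
    and dec_A: "decidable_in 1 (\<lambda>xs. xs ! 0 \<in> A)"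
    and dec_B: "decidable_in 1 (\<lambda>xs. xs ! 0 \<in> B)"
    and dec_adj: "decidable_in 2 (\<lambda>xs. adj (xs ! 0) (xs ! 1))"
    and comp_G: "computable_in 1 (\<lambda>xs. G (xs ! 0))"
    and comp_h: "computable_in 1 (\<lambda>xs. h (xs ! 0))"
begin

text \<open>
  Every vertex \<open>i \<in> A\<close> is replaced by the \<open>k\<close> copies \<open>k * i + t\<close>, \<open>t < k\<close>, and \<open>j \<in> B\<close> by the single
  copy \<open>k * j\<close>, which turns harem matchings into ordinary perfect matchings.
\<close>

definition A_copies :: "nat set" where
  "A_copies = {p. p div k \<in> A}"

definition B_copies :: "nat set" where
  "B_copies = {p. p div k \<in> B \<and> p mod k = 0}"

text \<open>The membership conditions discard numbers over \<open>B\<close> with nonzero residue,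
  which represent no vertex.\<close>

definition adj_copies :: "nat \<Rightarrow> nat \<Rightarrow> bool" where
  "adj_copies p q \<longleftrightarrow> adj (p div k) (q div k) \<and>
     (p \<in> A_copies \<or> p \<in> B_copies) \<and> (q \<in> A_copies \<or> q \<in> B_copies)"

lemma less_G_copies: "adj_copies p q \<Longrightarrow> p < n \<Longrightarrow> q < k * G n"
proof -
  assume "adj_copies p q" "p < n"
  then have "q div k < G n"
    using less_G[of "p div k" "q div k" n] div_le_dividend[of p k] by (simp add: adj_copies_def)
  then show "q < k * G n" using k by (simp add: div_less_iff_less_mult mult.commute)
qed

sublocale copies: two_sided_graph A_copies B_copies adj_copies
proof
  show "A_copies \<inter> B_copies = {}" using disjoint by (auto simp: A_copies_def B_copies_def)
next
  fix p q assume adj: "adj_copies p q"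
  then show "p \<in> A_copies \<and> q \<in> B_copies \<or> p \<in> B_copies \<and> q \<in> A_copies"
    using sides[of "p div k" "q div k"] disjoint by (auto simp: adj_copies_def A_copies_def B_copies_def)
  show "adj_copies q p" using adj adj_sym by (auto simp: adj_copies_def)
next
  fix p
  show "finite {q. adj_copies p q}"
    by (rule finite_subset[of _ "{..<k * G (Suc p)}"]) (auto intro: less_G_copies)
qed

text \<open>With \<open>Y\<close> the set of originals of \<open>X\<close>, at most \<open>k\<close>
  copies lie over each vertex, so \<open>k * h n \<le> card X\<close> forces
  \<open>h n \<le> card Y\<close>. Each neighbour of \<open>Y\<close> contributes its single
  copy.\<close>

lemma copies_expanding_A:
  assumes X: "finite X" "X \<subseteq> A_copies" "k * h n \<le> card X"
  shows "card X + n \<le> card (copies.Nb X)"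
proof -
  define Y where "Y = (\<lambda>p. p div k) ` X"
  have Y: "finite Y" "Y \<subseteq> A" using X by (auto simp: Y_def A_copies_def)
  have "inj_on (\<lambda>p. (p div k, p mod k)) X"
    by (rule inj_onI) (metis Pair_inject div_mult_mod_eq)
  moreover have "(\<lambda>p. (p div k, p mod k)) ` X \<subseteq> Y \<times> {..<k}" using k by (auto simp: Y_def)
  ultimately have "card X \<le> card (Y \<times> {..<k})" using Y by (intro card_inj_on_le) auto
  then have XY: "card X \<le> k * card Y" by (simp add: card_cartesian_product mult.commute)
  with X(3) have "k * h n \<le> k * card Y" by linarith
  then have "h n \<le> card Y" using k by simp
  with Y have "k * card Y + n \<le> card (Nb Y)" by (rule expanding_A)
  moreover have "card (Nb Y) \<le> card (copies.Nb X)"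
  proof (rule card_inj_on_le[of "\<lambda>j. k * j"])
    show "inj_on (\<lambda>j. k * j) (Nb Y)" using k by (intro inj_onI) simp
    show "(\<lambda>j. k * j) ` Nb Y \<subseteq> copies.Nb X"
    proof
      fix q assume "q \<in> (\<lambda>j. k * j) ` Nb Y"
      then obtain p j where pj: "p \<in> X" "adj (p div k) j" "q = k * j" by (auto simp: Nb_def Y_def)
      have "p \<in> A_copies" using pj X by blast
      moreover have "j \<in> B" using sides[OF pj(2)] \<open>p \<in> A_copies\<close> disjoint by (auto simp: A_copies_def)
      ultimately have "adj_copies p q" using pj k by (simp add: adj_copies_def B_copies_def)
      then show "q \<in> copies.Nb X" using pj by (auto simp: copies.Nb_def)
    qed
    show "finite (copies.Nb X)" using X by (rule_tac copies.finite_Nb)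
  qed
  ultimately show ?thesis using XY by linarith
qed

text \<open>Here \<open>X\<close> and its set of originals have the same size, while each neighbour
  in \<open>A\<close> contributes \<open>k\<close> copies; this turns the surplus \<open>n\<close>
  into \<open>k * n\<close>, which is at least \<open>n\<close>.\<close>

lemma copies_expanding_B:
  assumes X: "finite X" "X \<subseteq> B_copies" "k * h n \<le> card X"
  shows "card X + n \<le> card (copies.Nb X)"
proof -
  define Y where "Y = (\<lambda>p. p div k) ` X"
  have Y: "finite Y" "Y \<subseteq> B" using X by (auto simp: Y_def B_copies_def)
  have "inj_on (\<lambda>p. p div k) X"
  proof (rule inj_onI)
    fix p q assume "p \<in> X" "q \<in> X" "p div k = q div k"
    moreover have "p mod k = 0" "q mod k = 0"
      using X(2) \<open>p \<in> X\<close> \<open>q \<in> X\<close> unfolding B_copies_def by blast+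
    ultimately show "p = q" by (metis div_mult_mod_eq)
  qed
  then have XY: "card Y = card X" by (simp add: Y_def card_image)
  have "h n \<le> k * h n" using k by simp
  then have "h n \<le> card Y" using X XY by linarith
  with Y have "card Y + k * n \<le> k * card (Nb Y)" by (rule expanding_B)
  moreover have "card (Nb Y \<times> {..<k}) \<le> card (copies.Nb X)"
  proof (rule card_inj_on_le[of "\<lambda>(i, t). k * i + t"])
    have "i = i' \<and> t = t'" if "k * i + t = k * i' + t'" "t < k" "t' < k" for i t i' t'
    proof -
      have "i = (k * i + t) div k" "i' = (k * i' + t') div k" using that(2,3) by simp_all
      then have "i = i'" using that(1) by metis
      then show ?thesis using that(1) by simp
    qed
    then show "inj_on (\<lambda>(i, t). k * i + t) (Nb Y \<times> {..<k})" by (auto intro!: inj_onI)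
    show "(\<lambda>(i, t). k * i + t) ` (Nb Y \<times> {..<k}) \<subseteq> copies.Nb X"
    proof
      fix q assume "q \<in> (\<lambda>(i, t). k * i + t) ` (Nb Y \<times> {..<k})"
      then obtain p i t where pi: "p \<in> X" "adj (p div k) i" "q = k * i + t" "t < k"
        by (auto simp: Nb_def Y_def)
      have "p \<in> B_copies" using pi X by blast
      moreover have "i \<in> A" using sides[OF pi(2)] \<open>p \<in> B_copies\<close> disjoint by (auto simp: B_copies_def)
      ultimately have "adj_copies p q" using pi k by (simp add: adj_copies_def A_copies_def)
      then show "q \<in> copies.Nb X" using pi by (auto simp: copies.Nb_def)
    qed
    show "finite (copies.Nb X)" using X by (rule_tac copies.finite_Nb)
  qed
  moreover have "card (Nb Y \<times> {..<k}) = k * card (Nb Y)"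
    by (simp add: card_cartesian_product)
  moreover have "1 * n \<le> k * n" using k by (rule mult_le_mono1)
  ultimately show ?thesis using XY by linarith
qed

lemma dec_A_copies: "decidable_in 1 (\<lambda>xs. xs ! 0 \<in> A_copies)"
  unfolding A_copies_def mem_Collect_eq
  by (intro decidable_in_subst1[OF dec_A] computable_in_div computable_intros; simp)

lemma dec_B_copies: "decidable_in 1 (\<lambda>xs. xs ! 0 \<in> B_copies)"
  unfolding B_copies_def mem_Collect_eq
  by (intro decidable_in_subst1[OF dec_B] computable_in_div computable_in_mod computable_intros; simp)

sublocale copies: computable_expanding_graph A_copies B_copies adj_copies "\<lambda>n. k * G n" "\<lambda>n. k * h n"
proof
  show "n \<le> k * G n" for n using le_G[of n] k by (metis le_trans mult_1 mult_le_mono1)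
  show "k * h 0 = 0" by (simp add: h_0)
  show "card X + n \<le> card (copies.Nb X)"
    if "finite X" "X \<subseteq> A_copies \<or> X \<subseteq> B_copies" "k * h n \<le> card X" for X n
    using that copies_expanding_A copies_expanding_B by blast
  show "decidable_in 2 (\<lambda>xs. adj_copies (xs ! 0) (xs ! 1))"
    unfolding adj_copies_def
    by (intro decidable_in_subst2[OF dec_adj] decidable_in_subst1[OF dec_A_copies]
        decidable_in_subst1[OF dec_B_copies] computable_in_div computable_intros; simp)
  show "computable_in 1 (\<lambda>xs. k * G (xs ! 0))" by (intro computable_in_mult comp_G computable_in_const)
  show "computable_in 1 (\<lambda>xs. k * h (xs ! 0))" by (intro computable_in_mult comp_h computable_in_const)
qed (fact less_G_copies dec_A_copies dec_B_copies)+

section \<open>Return from copies to harem matchings\<close>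

definition harem :: "nat \<Rightarrow> nat \<Rightarrow> bool" where
  "harem i j \<longleftrightarrow> i \<in> A \<and> (\<exists>t<k. copies.partner (k * i + t) (k * j))"

lemma decidable_harem: "decidable_in 2 (\<lambda>xs. harem (xs ! 0) (xs ! 1))"
  unfolding harem_def
  by (intro decidable_in_subst1[OF dec_A] decidable_in_subst2[OF copies.decidable_partner]
      computable_intros; simp)

lemma harem_adj: "harem i j \<Longrightarrow> adj i j"
  using k by (auto simp: harem_def adj_copies_def dest!: copies.partner_adj)

text \<open>The \<open>k\<close> copies of \<open>i\<close> have partners in
  \<open>B_copies\<close>, which are multiples of \<open>k\<close>. Symmetry and uniqueness of
  \<open>partner\<close> make these distinct, and so are their quotients.\<close>

lemma card_harem:
  assumes i: "i \<in> A" shows "finite {j. harem i j}" "card {j. harem i j} = k"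
proof -
  have copy: "k * i + t \<in> A_copies" if "t < k" for t using that i by (simp add: A_copies_def)
  then have "\<forall>t. \<exists>q. t < k \<longrightarrow> copies.partner (k * i + t) q" using copies.partner_exists by blast
  then obtain f where f: "\<And>t. t < k \<Longrightarrow> copies.partner (k * i + t) (f t)" by metis
  have fk: "f t = k * (f t div k)" if "t < k" for t
  proof -
    have "f t \<in> B_copies"
      using copies.sides[OF copies.partner_adj[OF f[OF that]]] copy[OF that] copies.disjoint by blast
    then show ?thesis by (simp add: B_copies_def mod_0_imp_dvd)
  qed
  have "{j. harem i j} = (\<lambda>t. f t div k) ` {..<k}"
  proof (intro equalityI subsetI)
    fix j assume "j \<in> {j. harem i j}"
    then obtain t where t: "t < k" "copies.partner (k * i + t) (k * j)" by (auto simp: harem_def)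
    then have "f t = k * j" using f copies.partner_unique by blast
    then show "j \<in> (\<lambda>t. f t div k) ` {..<k}" using t k by (intro image_eqI[of _ _ t]) auto
  next
    fix j assume "j \<in> (\<lambda>t. f t div k) ` {..<k}"
    then show "j \<in> {j. harem i j}" using f fk i by (fastforce simp: harem_def)
  qed
  moreover have "inj_on (\<lambda>t. f t div k) {..<k}"
  proof (rule inj_onI)
    fix t t' assume t: "t \<in> {..<k}" "t' \<in> {..<k}" "f t div k = f t' div k"
    then have "f t = f t'" using fk by (metis lessThan_iff)
    then have "k * i + t = k * i + t'"
      using t f copies.partner_sym copies.partner_unique by (metis lessThan_iff)
    then show "t = t'" by simp
  qed
  ultimately show "finite {j. harem i j}" "card {j. harem i j} = k" by (simp_all add: card_image)
qed

text \<open>The single copy \<open>k * j\<close> has exactly one partner, and \<open>i\<close> must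
  be the original of that partner.\<close>

lemma ex1_harem:
  assumes j: "j \<in> B" shows "\<exists>!i. harem i j"
proof -
  have kj: "k * j \<in> B_copies" using j k by (simp add: B_copies_def)
  then obtain p where p: "copies.partner (k * j) p" using copies.partner_exists by blast
  have "p \<in> A_copies"
    using copies.sides[OF copies.partner_adj[OF p]] kj copies.disjoint by blast
  then have "harem (p div k) j"
    using copies.partner_sym[OF p] k by (auto simp: harem_def A_copies_def intro!: exI[of _ "p mod k"])
  moreover have "i = p div k" if "harem i j" for i
  proof -
    obtain t where t: "t < k" "copies.partner (k * i + t) (k * j)" using \<open>harem i j\<close> by (auto simp: harem_def)
    then have "k * i + t = p" using p copies.partner_sym copies.partner_unique by blast
    then show ?thesis using t by auto
  qed
  ultimately show ?thesis by blast
qed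

end

section \<open>Transfer along the numbering\<close>

theorem theorem2p9:
  fixes A B :: "'v set" and E :: "('v \<times> 'v) set" and \<nu> :: "nat \<Rightarrow> 'v" and k :: nat
  assumes "k \<ge> 1"
    and "bipartite_graph A B E"
    and "highly_computable \<nu> A B E"
    and "computably_bipartite \<nu> A B E"
    and "ceHhc k A B E"
  shows "\<exists>M. perfect_harem_matching k A B E M \<and> computable_edges \<nu> M"
proof -
  \<comment> \<open>The graph is pulled back along \<open>\<nu>\<close> to the natural numbers, with
    adjacency made symmetric.\<close>
  define adj where "adj i j \<longleftrightarrow> (\<nu> i, \<nu> j) \<in> E \<or> (\<nu> j, \<nu> i) \<in> E" for i j
  define deg where "deg i = card (nbhd E (\<nu> i))" for i
  have disjoint: "A \<inter> B = {}" and E: "E \<subseteq> A \<times> B" using assms(2) by (auto simp: bipartite_graph_def)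
  have bij: "bij_betw \<nu> UNIV (A \<union> B)" using assms(3) by (simp add: highly_computable_def computable_graph_def)
  then have inj: "inj \<nu>" and range: "range \<nu> = A \<union> B" by (auto simp: bij_betw_def)
  have in_B: "\<nu> i \<in> B \<longleftrightarrow> \<nu> i \<notin> A" for i using range disjoint by blast
  have nbhd: "nbhd E (\<nu> i) = \<nu> ` {j. adj i j}" for i
  proof -
    have "nbhd E (\<nu> i) \<subseteq> range \<nu>" using E by (auto simp: nbhd_def range)
    then show ?thesis by (auto simp: nbhd_def adj_def)
  qed
  have finite_adj: "finite {j. adj i j}" for i
  proof -
    have "\<nu> i \<in> A \<union> B" using range by blast
    then have "finite (nbhd E (\<nu> i))"
      using assms(3) by (simp add: highly_computable_def locally_finite_def)
    then show ?thesis unfolding nbhd using inj by (auto dest: finite_imageD intro: inj_on_subset)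
  qed
  have deg: "deg i = card {j. adj i j}" for i
    unfolding deg_def nbhd using inj by (auto intro!: card_image intro: inj_on_subset)
  have graph: "two_sided_graph (\<nu> -` A) (\<nu> -` B) adj"
  proof
    show "\<nu> -` A \<inter> \<nu> -` B = {}" using disjoint by auto
    show "i \<in> \<nu> -` A \<and> j \<in> \<nu> -` B \<or> i \<in> \<nu> -` B \<and> j \<in> \<nu> -` A" if "adj i j" for i j
      using that E by (auto simp: adj_def)
    show "adj j i" if "adj i j" for i j using that by (auto simp: adj_def)
  qed (rule finite_adj)
  interpret two_sided_graph "\<nu> -` A" "\<nu> -` B" adj by (rule graph)
  have card_nbhd_set: "card (nbhd_set E (\<nu> ` X)) = card (Nb X)" for X
  proof -
    have "nbhd_set E (\<nu> ` X) = \<nu> ` Nb X" by (auto simp: nbhd_set_def nbhd Nb_def)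
    then show ?thesis using inj by (auto intro!: card_image intro: inj_on_subset)
  qed
  have card_image_\<nu>: "card (\<nu> ` X) = card X" for X
    using inj by (auto intro!: card_image intro: inj_on_subset)

  \<comment> \<open>This is where computability of the degrees enters: all neighbours of
    \<open>i\<close> lie below \<open>g\<close> once as many as the degree have been found there.
    This is decidable, so \<open>G\<close> is obtained by search.\<close>
  define bound where "bound n g \<longleftrightarrow> n \<le> g \<and> (\<forall>i<n. card {j. j < g \<and> adj i j} = deg i)" for n g
  define G where "G n = (LEAST g. bound n g)" for n
  have ex_bound: "\<exists>g. bound n g" for n
  proof -
    have "finite (\<Union>i<n. {j. adj i j})" using finite_adj by blast
    then obtain m where "\<forall>j\<in>\<Union>i<n. {j. adj i j}. j < m" using finite_nat_set_iff_bounded by blast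
    then have "{j. j < max n m \<and> adj i j} = {j. adj i j}" if "i < n" for i using that by fastforce
    then show ?thesis by (intro exI[of _ "max n m"]) (simp add: bound_def deg)
  qed
  have bound_G: "bound n (G n)" for n unfolding G_def using ex_bound by (rule LeastI_ex)
  have less_G: "j < G n" if "adj i j" "i < n" for i j n
  proof -
    have "{j. j < G n \<and> adj i j} = {j. adj i j}"
      using bound_G[of n] \<open>i < n\<close> finite_adj by (intro card_subset_eq) (auto simp: bound_def deg)
    then show ?thesis using that by blast
  qed

  obtain h where h: "computable_fun h" "h 0 = 0"
    and hA: "\<And>X n. finite X \<and> X \<subseteq> A \<and> h n \<le> card X \<Longrightarrow>
      real n \<le> real (card (nbhd_set E X)) - real k * real (card X)"
    and hB: "\<And>Y n. finite Y \<and> Y \<subseteq> B \<and> h n \<le> card Y \<Longrightarrow>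
      real n \<le> real (card (nbhd_set E Y)) - 1 / real k * real (card Y)"
    using assms(5) unfolding ceHhc_def by blast
  have dec_E: "decidable_in 2 (\<lambda>xs. (\<nu> (xs ! 0), \<nu> (xs ! 1)) \<in> E)"
    using assms(3)
    by (simp add: highly_computable_def computable_graph_def computable_edges_def computable_rel_iff)
  have dec_adj: "decidable_in 2 (\<lambda>xs. adj (xs ! 0) (xs ! 1))"
    unfolding adj_def
    by (intro decidable_in_disj decidable_in_subst2[OF dec_E, of 2] computable_intros; simp)
  have dec_A: "decidable_in 1 (\<lambda>xs. xs ! 0 \<in> \<nu> -` A)"
    using assms(4) unfolding computably_bipartite_def computable_set_iff by blast
  have comp_deg: "computable_in 1 (\<lambda>xs. deg (xs ! 0))"
    using assms(3) unfolding highly_computable_def computable_fun_iff deg_def by blast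

  interpret harem_graph "\<nu> -` A" "\<nu> -` B" adj k G h
  proof
    show "n \<le> G n" for n using bound_G[of n] by (simp add: bound_def)
    show "k * card X + n \<le> card (Nb X)" if "finite X" "X \<subseteq> \<nu> -` A" "h n \<le> card X" for X n
    proof -
      have "real n \<le> real (card (Nb X)) - real k * real (card X)"
        using hA[of "\<nu> ` X" n] that by (auto simp: card_nbhd_set card_image_\<nu>)
      then have "real (k * card X + n) \<le> real (card (Nb X))" by simp
      then show ?thesis by (simp only: of_nat_le_iff)
    qed
    show "card X + k * n \<le> k * card (Nb X)" if "finite X" "X \<subseteq> \<nu> -` B" "h n \<le> card X" for X n
    proof -
      have "real n \<le> real (card (Nb X)) - 1 / real k * real (card X)"
        using hB[of "\<nu> ` X" n] that by (auto simp: card_nbhd_set card_image_\<nu>)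
      \<comment> \<open>Multiplication by \<open>k > 0\<close> clears the fraction, so that the
        condition can be stated in natural numbers.\<close>
      then have "real (card X + k * n) \<le> real (k * card (Nb X))"
        using assms(1) by (simp add: field_simps)
      then show ?thesis by (simp only: of_nat_le_iff)
    qed
    show "decidable_in 1 (\<lambda>xs. xs ! 0 \<in> \<nu> -` B)"
      using decidable_in_not[OF dec_A] by (simp add: in_B)
    show "computable_in 1 (\<lambda>xs. G (xs ! 0))"
      unfolding G_def
    proof (rule computable_in_Least)
      show "decidable_in (Suc 1) (\<lambda>ys. bound (tl ys ! 0) (ys ! 0))"
        unfolding bound_def
        by (intro computable_intros computable_in_subst1[OF comp_deg] decidable_in_subst2[OF dec_adj]; simp)
    qed (rule ex_bound)
    show "computable_in 1 (\<lambda>xs. h (xs ! 0))" using h(1) by (simp only: computable_fun_iff)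
  qed (fact assms(1) less_G h(2) dec_A dec_adj)+

  define M where "M = {(\<nu> i, \<nu> j) | i j. harem i j}"
  have M_iff: "(\<nu> i, \<nu> j) \<in> M \<longleftrightarrow> harem i j" for i j
    using inj by (auto simp: M_def inj_eq)
  have harem_A: "\<nu> i \<in> A" and harem_B: "\<nu> j \<in> B" if "harem i j" for i j
    using that harem_adj[OF that] E disjoint by (auto simp: harem_def adj_def)
  have "perfect_harem_matching k A B E M"
    unfolding perfect_harem_matching_def
  proof (intro conjI ballI)
    show "M \<subseteq> E"
    proof
      fix e assume "e \<in> M"
      then obtain i j where e: "e = (\<nu> i, \<nu> j)" "harem i j" by (auto simp: M_def)
      \<comment> \<open>\<open>harem_adj\<close> gives adjacency without orientation; membership of
        the first endpoint in \<open>A\<close> decides it.\<close>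
      then show "e \<in> E" using harem_adj[OF e(2)] harem_A[OF e(2)] E disjoint by (auto simp: adj_def)
    qed
  next
    fix a assume "a \<in> A"
    then obtain i where i: "a = \<nu> i" using range by blast
    have "{b \<in> B. (a, b) \<in> M} = \<nu> ` {j. harem i j}"
      using harem_B inj by (auto simp: M_def i inj_eq)
    then show "finite {b \<in> B. (a, b) \<in> M}" "card {b \<in> B. (a, b) \<in> M} = k"
      using card_harem[of i] \<open>a \<in> A\<close> by (simp_all add: i card_image_\<nu>)
  next
    fix b assume "b \<in> B"
    then obtain j where j: "b = \<nu> j" using range by blast
    then obtain i where i: "harem i j" "\<And>i'. harem i' j \<Longrightarrow> i' = i"
      using ex1_harem[of j] \<open>b \<in> B\<close> by auto
    show "\<exists>!a. a \<in> A \<and> (a, b) \<in> M"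
    proof (rule ex1I)
      show "\<nu> i \<in> A \<and> (\<nu> i, b) \<in> M" using i(1) harem_A by (simp add: j M_iff)
      show "a = \<nu> i" if "a \<in> A \<and> (a, b) \<in> M" for a
        using that i(2) inj by (auto simp: M_def j inj_eq)
    qed
  qed
  moreover have "computable_edges \<nu> M"
    using decidable_harem by (simp add: computable_edges_def computable_rel_iff M_iff)
  ultimately show ?thesis by blast
qed

end
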